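(* Let $G=G_\Gamma$ be a derived graph of a (symmetric) association scheme. Then a disjointness representation of $G$ is Delsarte-rigid if, and only if, it is Schrijver-rigid.
   Context: Graphs are finite, undirected and loopless; $\sim$ is adjacency; $[m]=\{1,\dots,m\}$. Association schemes. A symmetric association scheme on a finite set $X$ is a family $\mathfrak X=\{A_0,\dots,A_s\}$ of nonzero symmetric $0/1$ matrices indexed by $X\times X$ with $A_0=I$, $\sum_iA_i=J$ (all-ones), and $A_iA_j=A_jA_i\in\operatorname{span}_{\mathbb C}\{A_0,\dots,A_s\}$. The Bose–Mesner algebra is $\mathbb C[\mathfrak X]=\operatorname{span}_{\mathbb C}\{A_i\}$; it has a second basis of pairwise orthogonal real (symmetric) projection matrices $E_0=|X|^{-1}J,E_1,\dots,E_s$ with $\sum_jE_j=I$. For $\Gamma\subseteq[s]$, the derived graph $G_\Gamma$ has vertex set $X$ and adjacency matrix $\sum_{i\in\Gamma}A_i$. For $m\ge1$ the $m$-th tensor-power scheme on $X^m$ has bases $A_{\mathbf i}=A_{i_1}\otimes\cdots\otimes A_{i_m}$ and $E_{\mathbf j}=E_{j_1}\otimes\cdots\otimes E_{j_m}$, with $\mathbf i,\mathbf j\in\{0,\dots,s\}^m$. Disjointness representations. Let $G=(X,E)$, $v=|X|$. For a finite set $P$ and $1\le r\le|P|$, a $(P,r)$-disjointness representation of $G$ is an injective map $T:X\to\binom{P}{r}$, $x\mapsto T_x$, with $T_x\cap T_y=\emptyset$ whenever $x\sim_G y$, and $P=\bigcup_xT_x$. Let $\chi_p(x)=1$ if $p\in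 T_x$ and $0$ otherwise; the incidence space is $\mathcal L=\operatorname{span}\{\chi_p:p\in P\}\subseteq\mathbb C^X$; it contains $\mathbf 1$, and $U=\mathcal L\cap\mathbf 1^\perp$. Put $\mu=r/|P|$. Schrijver-rigidity. $G^m$ is the categorical power: vertex set $X^m$, $(x_i)\sim(y_i)$ iff $x_i\sim_Gy_i$ for all $i$. Put $\mathcal L^{[m]}=\operatorname{span}\{\mathbf 1_X^{\otimes(i-1)}\otimes\chi_p\otimes\mathbf 1_X^{\otimes(m-i)}:i\in[m],p\in P\}\subseteq\mathbb C^{X^m}$. A dual $\vartheta^-$ certificate for a graph with vertex set $Y$ at value $\beta$ is a real symmetric $Q\in\mathbb R^{Y\times Y}$ with $Q\succeq0$, $Q_{xx}=\beta-1$ for all $x$, and $Q_{xy}\le-1$ for distinct non-adjacent $x,y$. $T$ is Schrijver-rigid if for every $m\ge1$ the graph $G^m$ has a dual $\vartheta^-$ certificate $Q_m$ at value $rv^m/|P|$ with $\ker Q_m=\mathcal L^{[m]}$. Delsarte-rigidity. A representation $T$ of $G_\Gamma$ is scheme-compatible with index set $\Lambda\subseteq[s]$ if $U=\bigoplus_{j\in\Lambda}E_j\mathbb C^X$. Put $\Lambda^{[m]}=\{\mathbf 0\}\cup\{j\mathbf e_i:j\in\Lambda,i\in[m]\}\subseteq\{0,\dots,s\}^m$, where $j\mathbf e_i$ is the tuple with $j$ in position $i$ and $0$ elsewhere. $T$ is Delsarte-rigid if it is scheme-compatible (with some index set $\Lambda$) and for every $m\ge1$ there is a real symmetric matrix $F_m$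 in the Bose–Mesner algebra of the $m$-th tensor-power scheme such that, writing (uniquely) $F_m=\sum_{\mathbf i}f^{(m)}_{\mathbf i}A_{\mathbf i}=\sum_{\mathbf j}\lambda^{(m)}_{\mathbf j}E_{\mathbf j}$: (D1) $\lambda^{(m)}_{\mathbf 0}=1$ and $\lambda^{(m)}_{\mathbf j}\ge0$ for $\mathbf j\ne\mathbf 0$; (D2) $f^{(m)}_{\mathbf 0}=\mu$ and $f^{(m)}_{\mathbf i}\le0$ for $\mathbf i\notin\Gamma^m\cup\{\mathbf 0\}$; (D3) $\lambda^{(m)}_{\mathbf j}=0$ if and only if $\mathbf j\in\Lambda^{[m]}\setminus\{\mathbf 0\}$. *)

theory Defs
  imports Complex_Main "HOL-Library.FuncSet"
begin

text \<open>
  Since the powers of \<open>X\<close> have to be quantified over, index sets are explicit carriers \<open>Y\<close>.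
  A real matrix indexed by \<open>Y \<times> Y\<close> is a function of type \<open>'a \<Rightarrow> 'a \<Rightarrow> real\<close> of which only the
  entries on \<open>Y \<times> Y\<close> matter; a vector of \<open>\<complex>\<^sup>Y\<close> is a function of type \<open>'a \<Rightarrow> complex\<close> vanishing
  outside \<open>Y\<close>, so that subspaces of \<open>\<complex>\<^sup>Y\<close> can be compared as sets.
\<close>

section \<open>Matrices and vectors on a finite carrier\<close>

definition mat_eq :: "'a set \<Rightarrow> ('a \<Rightarrow> 'a \<Rightarrow> 'b) \<Rightarrow> ('a \<Rightarrow> 'a \<Rightarrow> 'b) \<Rightarrow> bool" where
  "mat_eq Y M N \<longleftrightarrow> (\<forall>x\<in>Y. \<forall>y\<in>Y. M x y = N x y)"

definition mat_mult :: "'a set \<Rightarrow> ('a \<Rightarrow> 'a \<Rightarrow> real) \<Rightarrow> ('a \<Rightarrow> 'a \<Rightarrow> real) \<Rightarrow> 'a \<Rightarrow> 'a \<Rightarrow> real" where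
  "mat_mult Y M N = (\<lambda>x y. \<Sum>z\<in>Y. M x z * N z y)"

definition mat_id :: "'a \<Rightarrow> 'a \<Rightarrow> real" where
  "mat_id = (\<lambda>x y. if x = y then 1 else 0)"

definition symmetric_mat :: "'a set \<Rightarrow> ('a \<Rightarrow> 'a \<Rightarrow> real) \<Rightarrow> bool" where
  "symmetric_mat Y M \<longleftrightarrow> mat_eq Y M (\<lambda>x y. M y x)"

definition psd_mat :: "'a set \<Rightarrow> ('a \<Rightarrow> 'a \<Rightarrow> real) \<Rightarrow> bool" where
  "psd_mat Y M \<longleftrightarrow> (\<forall>u :: 'a \<Rightarrow> real. (\<Sum>x\<in>Y. \<Sum>y\<in>Y. u x * M x y * u y) \<ge> 0)"

definition complexify :: "('a \<Rightarrow> 'a \<Rightarrow> real) \<Rightarrow> 'a \<Rightarrow> 'a \<Rightarrow> complex" where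
  "complexify M = (\<lambda>x y. complex_of_real (M x y))"

definition mat_vec :: "'a set \<Rightarrow> ('a \<Rightarrow> 'a \<Rightarrow> real) \<Rightarrow> ('a \<Rightarrow> complex) \<Rightarrow> 'a \<Rightarrow> complex" where
  "mat_vec Y M u = (\<lambda>x. if x \<in> Y then \<Sum>y\<in>Y. complex_of_real (M x y) * u y else 0)"

definition cvecs :: "'a set \<Rightarrow> ('a \<Rightarrow> complex) set" where
  "cvecs Y = {u. \<forall>x. x \<notin> Y \<longrightarrow> u x = 0}"

definition kernel :: "'a set \<Rightarrow> ('a \<Rightarrow> 'a \<Rightarrow> real) \<Rightarrow> ('a \<Rightarrow> complex) set" where
  "kernel Y M = {u \<in> cvecs Y. mat_vec Y M u = (\<lambda>x. 0)}"

definition col_space :: "'a set \<Rightarrow> ('a \<Rightarrow> 'a \<Rightarrow> real) \<Rightarrow> ('a \<Rightarrow> complex) set" where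
  "col_space Y M = mat_vec Y M ` cvecs Y"

definition ones :: "'a set \<Rightarrow> 'a \<Rightarrow> complex" where
  "ones Y = (\<lambda>x. if x \<in> Y then 1 else 0)"

text \<open>Linear span over the complex numbers of a family of vectors with finite index set.\<close>

definition vec_span :: "'i set \<Rightarrow> ('i \<Rightarrow> 'a \<Rightarrow> complex) \<Rightarrow> ('a \<Rightarrow> complex) set" where
  "vec_span I b = {u. \<exists>c. u = (\<lambda>x. \<Sum>i\<in>I. c i * b i x)}"

definition mat_comb :: "'i set \<Rightarrow> ('i \<Rightarrow> complex) \<Rightarrow> ('i \<Rightarrow> 'a \<Rightarrow> 'a \<Rightarrow> real) \<Rightarrow> 'a \<Rightarrow> 'a \<Rightarrow> complex" where
  "mat_comb I c B = (\<lambda>x y. \<Sum>i\<in>I. c i * complex_of_real (B i x y))"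

text \<open>Linear span over the complex numbers of a family of real matrices with finite index set.\<close>

definition mat_span :: "'a set \<Rightarrow> 'i set \<Rightarrow> ('i \<Rightarrow> 'a \<Rightarrow> 'a \<Rightarrow> real) \<Rightarrow> ('a \<Rightarrow> 'a \<Rightarrow> complex) set" where
  "mat_span Y I B = {M. \<exists>c. mat_eq Y M (mat_comb I c B)}"

definition mat_indep :: "'a set \<Rightarrow> 'i set \<Rightarrow> ('i \<Rightarrow> 'a \<Rightarrow> 'a \<Rightarrow> real) \<Rightarrow> bool" where
  "mat_indep Y I B \<longleftrightarrow>
     (\<forall>c. mat_eq Y (mat_comb I c B) (\<lambda>x y. 0) \<longrightarrow> (\<forall>i\<in>I. c i = 0))"

section \<open>Association schemes and their tensor powers\<close>

definition assoc_scheme :: "'a set \<Rightarrow> nat \<Rightarrow> (nat \<Rightarrow> 'a \<Rightarrow> 'a \<Rightarrow> real) \<Rightarrow> bool" where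
  "assoc_scheme X s A \<longleftrightarrow>
     finite X \<and>
     (\<forall>i\<le>s. \<not> mat_eq X (A i) (\<lambda>x y. 0) \<and> symmetric_mat X (A i) \<and>
             (\<forall>x\<in>X. \<forall>y\<in>X. A i x y \<in> {0, 1})) \<and>
     mat_eq X (A 0) mat_id \<and>
     mat_eq X (\<lambda>x y. \<Sum>i\<le>s. A i x y) (\<lambda>x y. 1) \<and>
     (\<forall>i\<le>s. \<forall>j\<le>s.
        mat_eq X (mat_mult X (A i) (A j)) (mat_mult X (A j) (A i)) \<and>
        complexify (mat_mult X (A i) (A j)) \<in> mat_span X {..s} A)"

text \<open>
  The second basis \<open>E\<^sub>0, \<dots>, E\<^sub>s\<close> of the Bose--Mesner algebra. It is determined by the scheme up to
  the order of \<open>E\<^sub>1, \<dots>, E\<^sub>s\<close>.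
\<close>

definition idempotent_basis ::
    "'a set \<Rightarrow> nat \<Rightarrow> (nat \<Rightarrow> 'a \<Rightarrow> 'a \<Rightarrow> real) \<Rightarrow> (nat \<Rightarrow> 'a \<Rightarrow> 'a \<Rightarrow> real) \<Rightarrow> bool" where
  "idempotent_basis X s A E \<longleftrightarrow>
     mat_indep X {..s} E \<and> mat_span X {..s} E = mat_span X {..s} A \<and>
     (\<forall>j\<le>s. symmetric_mat X (E j) \<and> mat_eq X (mat_mult X (E j) (E j)) (E j)) \<and>
     (\<forall>i\<le>s. \<forall>j\<le>s. i \<noteq> j \<longrightarrow> mat_eq X (mat_mult X (E i) (E j)) (\<lambda>x y. 0)) \<and>
     mat_eq X (E 0) (\<lambda>x y. 1 / real (card X)) \<and>
     mat_eq X (\<lambda>x y. \<Sum>j\<le>s. E j x y) mat_id"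

text \<open>Tuples are functions on \<open>{1..m}\<close>, made \<open>undefined\<close> elsewhere.\<close>

definition tuples :: "nat \<Rightarrow> 'a set \<Rightarrow> (nat \<Rightarrow> 'a) set" where
  "tuples m X = {1..m} \<rightarrow>\<^sub>E X"

definition tensor_mat ::
    "nat \<Rightarrow> (nat \<Rightarrow> 'a \<Rightarrow> 'a \<Rightarrow> real) \<Rightarrow> (nat \<Rightarrow> nat) \<Rightarrow> (nat \<Rightarrow> 'a) \<Rightarrow> (nat \<Rightarrow> 'a) \<Rightarrow> real" where
  "tensor_mat m B i = (\<lambda>x y. \<Prod>k\<in>{1..m}. B (i k) (x k) (y k))"

definition tensor_vec ::
    "nat \<Rightarrow> 'a set \<Rightarrow> (nat \<Rightarrow> 'a \<Rightarrow> complex) \<Rightarrow> (nat \<Rightarrow> 'a) \<Rightarrow> complex" where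
  "tensor_vec m X w = (\<lambda>x. if x \<in> tuples m X then \<Prod>k\<in>{1..m}. w k (x k) else 0)"

text \<open>A graph on a given vertex set is represented by its adjacency relation.\<close>

definition derived_adj :: "(nat \<Rightarrow> 'a \<Rightarrow> 'a \<Rightarrow> real) \<Rightarrow> nat set \<Rightarrow> 'a \<Rightarrow> 'a \<Rightarrow> bool" where
  "derived_adj A \<Gamma> x y \<longleftrightarrow> (\<Sum>i\<in>\<Gamma>. A i x y) = 1"

definition power_adj :: "nat \<Rightarrow> ('a \<Rightarrow> 'a \<Rightarrow> bool) \<Rightarrow> (nat \<Rightarrow> 'a) \<Rightarrow> (nat \<Rightarrow> 'a) \<Rightarrow> bool" where
  "power_adj m adj x y \<longleftrightarrow> (\<forall>i\<in>{1..m}. adj (x i) (y i))"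

section \<open>Disjointness representations\<close>

definition disjointness_rep ::
    "'a set \<Rightarrow> ('a \<Rightarrow> 'a \<Rightarrow> bool) \<Rightarrow> 'p set \<Rightarrow> nat \<Rightarrow> ('a \<Rightarrow> 'p set) \<Rightarrow> bool" where
  "disjointness_rep X adj P r T \<longleftrightarrow>
     finite P \<and> 1 \<le> r \<and> r \<le> card P \<and>
     inj_on T X \<and> (\<forall>x\<in>X. T x \<subseteq> P \<and> card (T x) = r) \<and>
     (\<forall>x\<in>X. \<forall>y\<in>X. adj x y \<longrightarrow> T x \<inter> T y = {}) \<and>
     P = (\<Union>x\<in>X. T x)"

definition chi :: "'a set \<Rightarrow> ('a \<Rightarrow> 'p set) \<Rightarrow> 'p \<Rightarrow> 'a \<Rightarrow> complex" where
  "chi X T p = (\<lambda>x. if x \<in> X \<and> p \<in> T x then 1 else 0)"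

definition incidence_space :: "'a set \<Rightarrow> 'p set \<Rightarrow> ('a \<Rightarrow> 'p set) \<Rightarrow> ('a \<Rightarrow> complex) set" where
  "incidence_space X P T = vec_span P (chi X T)"

definition incidence_perp :: "'a set \<Rightarrow> 'p set \<Rightarrow> ('a \<Rightarrow> 'p set) \<Rightarrow> ('a \<Rightarrow> complex) set" where
  "incidence_perp X P T = {u \<in> incidence_space X P T. (\<Sum>x\<in>X. u x) = 0}"

definition incidence_power ::
    "nat \<Rightarrow> 'a set \<Rightarrow> 'p set \<Rightarrow> ('a \<Rightarrow> 'p set) \<Rightarrow> ((nat \<Rightarrow> 'a) \<Rightarrow> complex) set" where
  "incidence_power m X P T =
     vec_span ({1..m} \<times> P)
       (\<lambda>(i, p). tensor_vec m X (\<lambda>k. if k = i then chi X T p else ones X))"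

section \<open>Schrijver-rigidity\<close>

definition dual_certificate ::
    "'a set \<Rightarrow> ('a \<Rightarrow> 'a \<Rightarrow> bool) \<Rightarrow> real \<Rightarrow> ('a \<Rightarrow> 'a \<Rightarrow> real) \<Rightarrow> bool" where
  "dual_certificate Y adj \<beta> Q \<longleftrightarrow>
     symmetric_mat Y Q \<and> psd_mat Y Q \<and>
     (\<forall>x\<in>Y. Q x x = \<beta> - 1) \<and>
     (\<forall>x\<in>Y. \<forall>y\<in>Y. x \<noteq> y \<and> \<not> adj x y \<longrightarrow> Q x y \<le> -1)"

definition Schrijver_rigid ::
    "'a set \<Rightarrow> ('a \<Rightarrow> 'a \<Rightarrow> bool) \<Rightarrow> 'p set \<Rightarrow> nat \<Rightarrow> ('a \<Rightarrow> 'p set) \<Rightarrow> bool" where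
  "Schrijver_rigid X adj P r T \<longleftrightarrow>
     (\<forall>m\<ge>1. \<exists>Q.
        dual_certificate (tuples m X) (power_adj m adj)
          (real r * real (card X) ^ m / real (card P)) Q \<and>
        kernel (tuples m X) Q = incidence_power m X P T)"

section \<open>Delsarte-rigidity\<close>

text \<open>
  The sum of the spaces \<open>E\<^sub>j \<complex>\<^sup>X\<close> is automatically direct when the \<open>E\<^sub>j\<close> are pairwise orthogonal
  idempotents.
\<close>

definition scheme_compatible ::
    "'a set \<Rightarrow> nat \<Rightarrow> (nat \<Rightarrow> 'a \<Rightarrow> 'a \<Rightarrow> real) \<Rightarrow> 'p set \<Rightarrow> ('a \<Rightarrow> 'p set) \<Rightarrow> nat set \<Rightarrow> bool" where
  "scheme_compatible X s E P T \<Lambda> \<longleftrightarrow>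
     \<Lambda> \<subseteq> {1..s} \<and>
     incidence_perp X P T =
       {u. \<exists>w. (\<forall>j\<in>\<Lambda>. w j \<in> col_space X (E j)) \<and> u = (\<lambda>x. \<Sum>j\<in>\<Lambda>. w j x)}"

definition zero_index :: "nat \<Rightarrow> nat \<Rightarrow> nat" where
  "zero_index m = (\<lambda>k\<in>{1..m}. 0)"

definition unit_index :: "nat \<Rightarrow> nat \<Rightarrow> nat \<Rightarrow> nat \<Rightarrow> nat" where
  "unit_index m i j = (\<lambda>k\<in>{1..m}. if k = i then j else 0)"

definition index_power :: "nat \<Rightarrow> nat set \<Rightarrow> (nat \<Rightarrow> nat) set" where
  "index_power m \<Lambda> = {zero_index m} \<union> {unit_index m i j | i j. j \<in> \<Lambda> \<and> i \<in> {1..m}}"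

text \<open>
  \<open>f\<close> and \<open>l\<close> are the coefficients of the real matrix \<open>F\<close> in the bases \<open>A\<^sub>i\<close> and \<open>E\<^sub>j\<close> of the
  \<open>m\<close>-th tensor power; they are unique, and real because both bases consist of real matrices.
\<close>

definition Delsarte_rigid ::
    "'a set \<Rightarrow> nat \<Rightarrow> (nat \<Rightarrow> 'a \<Rightarrow> 'a \<Rightarrow> real) \<Rightarrow> (nat \<Rightarrow> 'a \<Rightarrow> 'a \<Rightarrow> real) \<Rightarrow> nat set \<Rightarrow>
     'p set \<Rightarrow> nat \<Rightarrow> ('a \<Rightarrow> 'p set) \<Rightarrow> bool" where
  "Delsarte_rigid X s A E \<Gamma> P r T \<longleftrightarrow>
     (\<exists>\<Lambda>. scheme_compatible X s E P T \<Lambda> \<and>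
       (\<forall>m\<ge>1. \<exists>F :: (nat \<Rightarrow> 'a) \<Rightarrow> (nat \<Rightarrow> 'a) \<Rightarrow> real.
          \<exists>f l :: (nat \<Rightarrow> nat) \<Rightarrow> real.
          symmetric_mat (tuples m X) F \<and>
          complexify F \<in> mat_span (tuples m X) (tuples m {..s}) (tensor_mat m A) \<and>
          mat_eq (tuples m X) F (\<lambda>x y. \<Sum>i\<in>tuples m {..s}. f i * tensor_mat m A i x y) \<and>
          mat_eq (tuples m X) F (\<lambda>x y. \<Sum>j\<in>tuples m {..s}. l j * tensor_mat m E j x y) \<and>
          l (zero_index m) = 1 \<and>
          (\<forall>j\<in>tuples m {..s}. j \<noteq> zero_index m \<longrightarrow> l j \<ge> 0) \<and>
          f (zero_index m) = real r / real (card P) \<and>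
          (\<forall>i\<in>tuples m {..s}. i \<notin> tuples m \<Gamma> \<union> {zero_index m} \<longrightarrow> f i \<le> 0) \<and>
          (\<forall>j\<in>tuples m {..s}. l j = 0 \<longleftrightarrow> j \<in> index_power m \<Lambda> - {zero_index m})))"

end

theory Submission imports Defs begin

text \<open>
  Write \<open>N = |X|\<^sup>m\<close>. The two kinds of certificate are exchanged by \<open>Q = N F - J\<close> and
  \<open>F = (Q + J) / N\<close>. Since \<open>J = \<Sum>\<^sub>i A\<^sub>i = N E\<^sub>0\<close>, this shifts every coefficient in
  the basis \<open>A\<close> but only the coefficient of \<open>E\<^sub>0\<close> in the basis \<open>E\<close>. So the sign conditions on
  the \<open>A\<close>-coefficients of \<open>F\<close> become the entry conditions on \<open>Q\<close>, those on the \<open>E\<close>-coefficients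
  become positive semidefiniteness, and the kernel of \<open>Q\<close> is the sum of the eigenspaces whose
  coefficient vanishes. If the representation is scheme-compatible with index set \<open>\<Lambda>\<close>, then
  \<open>\<L>\<^bsup>[m]\<^esup>\<close> is the sum of the eigenspaces indexed by \<open>\<Lambda>\<^bsup>[m]\<^esup>\<close>
  (\<open>incidence_power_eq_spectral_space\<close>). This settles the direction from Delsarte to Schrijver.

  Conversely, a Schrijver certificate \<open>Q\<close> need not lie in the Bose--Mesner algebra, and is
  replaced by its orthogonal projection onto that algebra for the trace inner product. The
  coefficient of \<open>A\<^sub>i\<close> is the average of \<open>Q\<close> over the \<open>i\<close>-th relation, so the entry
  conditions survive. The coefficient of \<open>E\<^sub>j\<close> is a positive multiple of
  \<open>tr (E\<^sub>j Q E\<^sub>j)\<close>, so it is nonnegative, and it vanishes exactly if the column space of \<open>E\<^sub>j\<close>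
  lies in \<open>ker Q\<close> (\<open>proj_coeff_E_eq_0_iff\<close>).

  It remains to see that the representation is scheme-compatible, and for this \<open>m = 1\<close> suffices.
  The kernel of the projection \<open>Q'\<close> is the sum of those eigenspaces that are contained in
  \<open>ker Q = \<L>\<close>, hence contained in \<open>\<L>\<close>. For the other inclusion,
  \<open>Q'\<close> is again a dual certificate at the value \<open>r|X|/|P|\<close>, which the primal solution
  \<open>\<Sum>\<^sub>p \<chi>\<^sub>p \<chi>\<^sub>p\<^sup>T\<close>, scaled to trace \<open>1\<close>, reaches; complementary slackness gives \<open>Q' \<chi>\<^sub>p = 0\<close>
  for all \<open>p\<close> (\<open>dual_certificate_kills_chi\<close>). So \<open>\<L> = ker Q'\<close> is a sum of eigenspaces.
\<close>

section \<open>Spans, matrix-vector products and columns\<close>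

lemma vec_span_generator:
  assumes "finite I" "i \<in> I"
  shows "b i \<in> vec_span I b"
proof -
  have "(\<Sum>k\<in>I. (if k = i then 1 else 0) * b k x) = (\<Sum>k\<in>I. if k = i then b i x else 0)" for x
    by (intro sum.cong) auto
  then have "b i = (\<lambda>x. \<Sum>k\<in>I. (if k = i then 1 else 0) * b k x)"
    using assms by simp
  then show ?thesis unfolding vec_span_def
    by (intro CollectI exI[of _ "\<lambda>k. if k = i then 1 else 0"])
qed

lemma vec_span_combination:
  assumes "\<And>z. z \<in> Z \<Longrightarrow> w z \<in> vec_span I b"
  shows "(\<lambda>x. \<Sum>z\<in>Z. a z * w z x) \<in> vec_span I b"
proof -
  have "\<forall>z\<in>Z. \<exists>c. w z = (\<lambda>x. \<Sum>i\<in>I. c i * b i x)"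
    using assms by (auto simp: vec_span_def)
  then obtain c where c: "\<And>z. z \<in> Z \<Longrightarrow> w z = (\<lambda>x. \<Sum>i\<in>I. c z i * b i x)"
    by metis
  have "(\<Sum>z\<in>Z. a z * w z x) = (\<Sum>i\<in>I. (\<Sum>z\<in>Z. a z * c z i) * b i x)" for x
  proof -
    have "(\<Sum>z\<in>Z. a z * w z x) = (\<Sum>z\<in>Z. \<Sum>i\<in>I. a z * c z i * b i x)"
      using c by (intro sum.cong) (auto simp: sum_distrib_left mult.assoc)
    also have "\<dots> = (\<Sum>i\<in>I. (\<Sum>z\<in>Z. a z * c z i) * b i x)"
      by (subst sum.swap) (simp add: sum_distrib_right)
    finally show ?thesis .
  qed
  then have "(\<lambda>x. \<Sum>z\<in>Z. a z * w z x) = (\<lambda>x. \<Sum>i\<in>I. (\<Sum>z\<in>Z. a z * c z i) * b i x)"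
    by blast
  then show ?thesis unfolding vec_span_def by (intro CollectI exI[of _ "\<lambda>i. \<Sum>z\<in>Z. a z * c z i"])
qed

lemma mat_vec_in_cvecs [simp]: "mat_vec Y M u \<in> cvecs Y"
  by (simp add: mat_vec_def cvecs_def)

lemma mat_vec_zero_vec [simp]: "mat_vec Y M (\<lambda>x. 0) = (\<lambda>x. 0)"
  by (simp add: mat_vec_def fun_eq_iff)

lemma mat_vec_cong:
  assumes "mat_eq Y M N"
  shows "mat_vec Y M u = mat_vec Y N u"
  using assms by (auto simp: mat_vec_def mat_eq_def fun_eq_iff intro!: sum.cong)

lemma mat_vec_sum:
  "mat_vec Y M (\<lambda>x. \<Sum>i\<in>I. c i * b i x) = (\<lambda>x. \<Sum>i\<in>I. c i * mat_vec Y M (b i) x)"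
proof
  fix x
  have "(\<Sum>y\<in>Y. complex_of_real (M x y) * (\<Sum>i\<in>I. c i * b i y)) =
        (\<Sum>i\<in>I. c i * (\<Sum>y\<in>Y. complex_of_real (M x y) * b i y))"
    by (simp add: sum_distrib_left mult_ac) (rule sum.swap)
  then show "mat_vec Y M (\<lambda>x. \<Sum>i\<in>I. c i * b i x) x = (\<Sum>i\<in>I. c i * mat_vec Y M (b i) x)"
    by (simp add: mat_vec_def)
qed

lemma mat_vec_combination:
  assumes "\<And>x y. x \<in> Y \<Longrightarrow> y \<in> Y \<Longrightarrow> M x y = (\<Sum>j\<in>I. l j * B j x y)"
  shows "mat_vec Y M u = (\<lambda>x. \<Sum>j\<in>I. complex_of_real (l j) * mat_vec Y (B j) u x)"
proof
  fix x
  show "mat_vec Y M u x = (\<Sum>j\<in>I. complex_of_real (l j) * mat_vec Y (B j) u x)"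
  proof (cases "x \<in> Y")
    case True
    have "(\<Sum>y\<in>Y. complex_of_real (M x y) * u y) =
          (\<Sum>y\<in>Y. \<Sum>j\<in>I. complex_of_real (l j) * (complex_of_real (B j x y) * u y))"
      using True by (intro sum.cong) (auto simp: assms sum_distrib_right mult.assoc)
    also have "\<dots> = (\<Sum>j\<in>I. complex_of_real (l j) * (\<Sum>y\<in>Y. complex_of_real (B j x y) * u y))"
      by (subst sum.swap) (simp add: sum_distrib_left)
    finally show ?thesis using True by (simp add: mat_vec_def)
  qed (simp add: mat_vec_def)
qed

lemma mat_vec_mat_mult: "mat_vec Y M (mat_vec Y N u) = mat_vec Y (mat_mult Y M N) u"
proof
  fix x
  have "(\<Sum>y\<in>Y. complex_of_real (M x y) * (\<Sum>z\<in>Y. complex_of_real (N y z) * u z)) =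
        (\<Sum>z\<in>Y. (\<Sum>y\<in>Y. complex_of_real (M x y) * complex_of_real (N y z)) * u z)"
    by (simp add: sum_distrib_left sum_distrib_right mult.assoc) (rule sum.swap)
  then show "mat_vec Y M (mat_vec Y N u) x = mat_vec Y (mat_mult Y M N) u x"
    by (simp add: mat_vec_def mat_mult_def)
qed

definition column :: "'a set \<Rightarrow> ('a \<Rightarrow> 'a \<Rightarrow> real) \<Rightarrow> 'a \<Rightarrow> 'a \<Rightarrow> complex" where
  "column Y M z = (\<lambda>x. if x \<in> Y then complex_of_real (M x z) else 0)"

lemma column_in_cvecs [simp]: "column Y M z \<in> cvecs Y"
  by (simp add: column_def cvecs_def)

lemma mat_vec_columns: "mat_vec Y M u = (\<lambda>x. \<Sum>z\<in>Y. u z * column Y M z x)"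
  by (auto simp: mat_vec_def column_def fun_eq_iff intro!: sum.cong)

lemma mat_vec_column:
  assumes "z \<in> Y"
  shows "mat_vec Y M (column Y N z) = column Y (mat_mult Y M N) z"
  using assms by (auto simp: mat_vec_def column_def mat_mult_def fun_eq_iff intro!: sum.cong)

section \<open>Positive semidefinite matrices\<close>

text \<open>
  Perturbing an isotropic vector \<open>u\<close> to \<open>u + t Q u\<close> changes the form by
  \<open>2 t |Q u|\<^sup>2 + O(t\<^sup>2)\<close>, which is negative for small \<open>t < 0\<close> unless \<open>Q u = 0\<close>.
\<close>

lemma psd_isotropic_kernel:
  assumes fin: "finite Y" and sym: "symmetric_mat Y Q" and psd: "psd_mat Y Q"
    and iso: "(\<Sum>x\<in>Y. \<Sum>y\<in>Y. u x * Q x y * u y) = 0" and x: "x \<in> Y"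
  shows "(\<Sum>y\<in>Y. Q x y * u y) = 0"
proof -
  define w where "w = (\<lambda>x. \<Sum>y\<in>Y. Q x y * u y)"
  define a where "a = (\<Sum>x\<in>Y. w x * w x)"
  define b where "b = (\<Sum>x\<in>Y. \<Sum>y\<in>Y. w x * Q x y * w y)"
  have a1: "(\<Sum>x\<in>Y. \<Sum>y\<in>Y. w x * Q x y * u y) = a"
    by (simp add: a_def w_def sum_distrib_left mult.assoc)
  have "(\<Sum>x\<in>Y. \<Sum>y\<in>Y. u x * Q x y * w y) = (\<Sum>y\<in>Y. \<Sum>x\<in>Y. w y * Q y x * u x)"
    using sym by (subst sum.swap)
      (auto simp: symmetric_mat_def mat_eq_def mult_ac intro!: sum.cong)
  then have a2: "(\<Sum>x\<in>Y. \<Sum>y\<in>Y. u x * Q x y * w y) = a" using a1 by simp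
  have expand: "0 \<le> 2 * t * a + t * t * b" for t
  proof -
    have "0 \<le> (\<Sum>x\<in>Y. \<Sum>y\<in>Y. (u x + t * w x) * Q x y * (u y + t * w y))"
      using psd unfolding psd_mat_def by (rule spec)
    also have "\<dots> = (\<Sum>x\<in>Y. \<Sum>y\<in>Y. u x * Q x y * u y + t * (u x * Q x y * w y)
        + t * (w x * Q x y * u y) + t * t * (w x * Q x y * w y))"
      by (intro sum.cong) (auto simp: algebra_simps)
    also have "\<dots> = 2 * t * a + t * t * b"
      by (simp add: sum.distrib iso a1 a2 b_def flip: sum_distrib_left)
    finally show ?thesis .
  qed
  have a0: "a \<ge> 0" unfolding a_def by (intro sum_nonneg) simp
  have b0: "b \<ge> 0" using psd unfolding psd_mat_def b_def by (rule spec)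
  have "a = 0"
  proof (rule ccontr)
    assume "a \<noteq> 0"
    with a0 have ap: "a > 0" by simp
    define t where "t = - a / (b + 1)"
    have at: "a = - (t * (b + 1))" using b0 by (simp add: t_def)
    have "0 \<le> - (t * t * (b + 2))" using expand[of t] by (simp add: at algebra_simps)
    moreover have "t * t * (b + 2) > 0"
    proof -
      have "t \<noteq> 0" using ap b0 by (simp add: t_def)
      then have "t * t > 0" by (auto simp: zero_less_mult_iff linorder_neq_iff)
      then show ?thesis using b0 by simp
    qed
    ultimately show False by simp
  qed
  then have "w x * w x = 0"
    using x fin unfolding a_def by (subst (asm) sum_nonneg_eq_0_iff) auto
  then show ?thesis by (simp add: w_def)
qed

section \<open>The two bases of a Bose--Mesner algebra\<close>

definition mat_inner :: "'a set \<Rightarrow> ('a \<Rightarrow> 'a \<Rightarrow> real) \<Rightarrow> ('a \<Rightarrow> 'a \<Rightarrow> real) \<Rightarrow> real" where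
  "mat_inner Y M N = (\<Sum>x\<in>Y. \<Sum>y\<in>Y. M x y * N x y)"

lemma mat_inner_combination:
  assumes "\<And>x y. x \<in> Y \<Longrightarrow> y \<in> Y \<Longrightarrow> M x y = (\<Sum>i\<in>I. c i * B i x y)"
  shows "mat_inner Y M N = (\<Sum>i\<in>I. c i * mat_inner Y (B i) N)"
proof -
  have "mat_inner Y M N = (\<Sum>x\<in>Y. \<Sum>y\<in>Y. \<Sum>i\<in>I. c i * (B i x y * N x y))"
    unfolding mat_inner_def by (intro sum.cong) (auto simp: assms sum_distrib_right mult.assoc)
  also have "\<dots> = (\<Sum>x\<in>Y. \<Sum>i\<in>I. \<Sum>y\<in>Y. c i * (B i x y * N x y))"
    by (intro sum.cong refl sum.swap)
  also have "\<dots> = (\<Sum>i\<in>I. \<Sum>x\<in>Y. \<Sum>y\<in>Y. c i * (B i x y * N x y))"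
    by (rule sum.swap)
  finally show ?thesis by (simp add: mat_inner_def sum_distrib_left)
qed

lemma mat_inner_commute: "mat_inner Y M N = mat_inner Y N M"
  by (simp add: mat_inner_def mult.commute)

lemma mat_inner_self_pos:
  assumes "finite Y" "\<not> mat_eq Y M (\<lambda>x y. 0)"
  shows "mat_inner Y M M > 0"
proof -
  obtain x y where xy: "x \<in> Y" "y \<in> Y" "M x y \<noteq> 0"
    using assms(2) by (auto simp: mat_eq_def)
  have "0 < (\<Sum>y\<in>Y. M x y * M x y)"
    by (rule sum_pos2[of _ y]) (use xy assms(1) in \<open>auto simp: zero_less_mult_iff linorder_neq_iff\<close>)
  then show ?thesis unfolding mat_inner_def
    by (rule sum_pos2[OF assms(1) xy(1)]) (simp add: sum_nonneg)
qed

text \<open>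
  The coefficient of \<open>B\<close> in the orthogonal projection of \<open>Q\<close> onto a space with an orthogonal basis
  containing \<open>B\<close>. Both bases of the Bose--Mesner algebra are orthogonal, so the same formula serves
  for both.
\<close>

definition proj_coeff :: "'a set \<Rightarrow> ('a \<Rightarrow> 'a \<Rightarrow> real) \<Rightarrow> ('a \<Rightarrow> 'a \<Rightarrow> real) \<Rightarrow> real" where
  "proj_coeff Y Q B = mat_inner Y Q B / mat_inner Y B B"

text \<open>
  For a complete family of orthogonal idempotents this is the sum of the column spaces of the
  \<open>E j\<close> with \<open>j \<in> S\<close>. The description by the vanishing of the other components is the one that
  appears in kernels, and it makes membership testable on each \<open>E j\<close> separately.
\<close>

definition spectral_space ::
    "'a set \<Rightarrow> 'i set \<Rightarrow> ('i \<Rightarrow> 'a \<Rightarrow> 'a \<Rightarrow> real) \<Rightarrow> 'i set \<Rightarrow> ('a \<Rightarrow> complex) set" where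
  "spectral_space Y I E S = {u \<in> cvecs Y. \<forall>j\<in>I - S. mat_vec Y (E j) u = (\<lambda>x. 0)}"

text \<open>
  These properties of the two bases are all that the argument uses about a scheme, and they pass to
  tensor powers; the index type is arbitrary so that indices may be tuples. The spans
  are stated with real coefficients. Closure under multiplication is encoded by the idempotent
  relations.
\<close>

locale scheme_bases =
  fixes Y :: "'a set" and I :: "'i set" and i0 :: 'i and A E :: "'i \<Rightarrow> 'a \<Rightarrow> 'a \<Rightarrow> real"
  assumes finite_Y: "finite Y" and Y_nonempty: "Y \<noteq> {}"
    and finite_I: "finite I" and i0_in_I: "i0 \<in> I"
    and A_01: "\<And>i x y. i \<in> I \<Longrightarrow> x \<in> Y \<Longrightarrow> y \<in> Y \<Longrightarrow> A i x y \<in> {0, 1}"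
    and A_nonzero: "\<And>i. i \<in> I \<Longrightarrow> \<not> mat_eq Y (A i) (\<lambda>x y. 0)"
    and A_sum: "\<And>x y. x \<in> Y \<Longrightarrow> y \<in> Y \<Longrightarrow> (\<Sum>i\<in>I. A i x y) = 1"
    and A_i0: "\<And>x y. x \<in> Y \<Longrightarrow> y \<in> Y \<Longrightarrow> A i0 x y = (if x = y then 1 else 0)"
    and E_sym: "\<And>j x y. j \<in> I \<Longrightarrow> x \<in> Y \<Longrightarrow> y \<in> Y \<Longrightarrow> E j x y = E j y x"
    and E_mult: "\<And>j k x y. j \<in> I \<Longrightarrow> k \<in> I \<Longrightarrow> x \<in> Y \<Longrightarrow> y \<in> Y \<Longrightarrow>
          (\<Sum>z\<in>Y. E j x z * E k z y) = (if j = k then E j x y else 0)"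
    and E_sum: "\<And>x y. x \<in> Y \<Longrightarrow> y \<in> Y \<Longrightarrow> (\<Sum>j\<in>I. E j x y) = (if x = y then 1 else 0)"
    and E_i0: "\<And>x y. x \<in> Y \<Longrightarrow> y \<in> Y \<Longrightarrow> E i0 x y = 1 / real (card Y)"
    and E_nonzero: "\<And>j. j \<in> I \<Longrightarrow> \<not> mat_eq Y (E j) (\<lambda>x y. 0)"
    and A_in_span_E: "\<And>i. i \<in> I \<Longrightarrow> \<exists>c. \<forall>x\<in>Y. \<forall>y\<in>Y. A i x y = (\<Sum>j\<in>I. c j * E j x y)"
    and E_in_span_A: "\<And>j. j \<in> I \<Longrightarrow> \<exists>c. \<forall>x\<in>Y. \<forall>y\<in>Y. E j x y = (\<Sum>i\<in>I. c i * A i x y)"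
begin

lemma relation_exists:
  assumes "x \<in> Y" "y \<in> Y"
  obtains i where "i \<in> I" "A i x y = 1"
proof -
  have "\<exists>i\<in>I. A i x y \<noteq> 0"
    using A_sum[OF assms] by (metis sum.neutral zero_neq_one)
  then show ?thesis using A_01 assms that by fastforce
qed

lemma relation_unique:
  assumes "x \<in> Y" "y \<in> Y" "i \<in> I" "A i x y = 1" "k \<in> I" "k \<noteq> i"
  shows "A k x y = 0"
proof -
  have "(\<Sum>j\<in>I. A j x y) = A i x y + (\<Sum>j\<in>I - {i}. A j x y)"
    using assms finite_I by (simp add: sum.remove)
  then have "(\<Sum>j\<in>I - {i}. A j x y) = 0" using A_sum assms by simp
  moreover have "\<forall>j\<in>I - {i}. A j x y \<ge> 0" using A_01 assms by fastforce
  ultimately show ?thesis using finite_I assms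
    by (subst (asm) sum_nonneg_eq_0_iff) auto
qed

lemma A_combination_entry:
  assumes "x \<in> Y" "y \<in> Y" "i \<in> I" "A i x y = 1"
  shows "(\<Sum>k\<in>I. f k * A k x y) = f i"
proof -
  have "(\<Sum>k\<in>I. f k * A k x y) = (\<Sum>k\<in>I. if k = i then f i else 0)"
    using relation_unique[OF assms] assms(4) by (intro sum.cong) auto
  then show ?thesis using assms(3) finite_I by simp
qed

lemma A_orthogonal:
  assumes "i \<in> I" "k \<in> I" "i \<noteq> k"
  shows "mat_inner Y (A i) (A k) = 0"
  unfolding mat_inner_def
proof (intro sum.neutral ballI)
  fix x y assume xy: "x \<in> Y" "y \<in> Y"
  show "A i x y * A k x y = 0"
    using relation_unique[OF xy assms(1) _ assms(2)] A_01[OF assms(1) xy] assms(3) by auto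
qed

lemma E_orthogonal:
  assumes "j \<in> I" "k \<in> I" "j \<noteq> k"
  shows "mat_inner Y (E j) (E k) = 0"
  unfolding mat_inner_def
proof (rule sum.neutral, rule ballI)
  fix x assume x: "x \<in> Y"
  have "(\<Sum>y\<in>Y. E j x y * E k x y) = (\<Sum>y\<in>Y. E j x y * E k y x)"
    using x assms by (intro sum.cong) (auto simp: E_sym)
  then show "(\<Sum>y\<in>Y. E j x y * E k x y) = 0" using E_mult[OF assms(1,2) x x] assms(3) by simp
qed

lemma A_norm_pos: "i \<in> I \<Longrightarrow> mat_inner Y (A i) (A i) > 0"
  using mat_inner_self_pos[OF finite_Y A_nonzero] .

lemma E_norm_pos: "j \<in> I \<Longrightarrow> mat_inner Y (E j) (E j) > 0"
  using mat_inner_self_pos[OF finite_Y E_nonzero] .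

lemma E_mat_vec:
  assumes "j \<in> I" "k \<in> I"
  shows "mat_vec Y (E j) (mat_vec Y (E k) u) = (if j = k then mat_vec Y (E j) u else (\<lambda>x. 0))"
proof -
  have "mat_vec Y (E j) (mat_vec Y (E k) u) = mat_vec Y (\<lambda>x y. if j = k then E j x y else 0) u"
    unfolding mat_vec_mat_mult
    by (rule mat_vec_cong) (simp add: mat_eq_def mat_mult_def E_mult[OF assms])
  then show ?thesis by (auto simp: mat_vec_def)
qed

lemma spectral_decomposition:
  assumes "u \<in> cvecs Y"
  shows "u = (\<lambda>x. \<Sum>j\<in>I. mat_vec Y (E j) u x)"
proof -
  have "mat_vec Y mat_id u = (\<lambda>x. \<Sum>j\<in>I. complex_of_real 1 * mat_vec Y (E j) u x)"
    by (rule mat_vec_combination) (simp add: mat_id_def E_sum)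
  moreover have "mat_vec Y mat_id u = u"
    using assms finite_Y
    by (auto simp: mat_vec_def mat_id_def fun_eq_iff cvecs_def
        if_distrib[of complex_of_real] if_distrib[of "\<lambda>a. a * _"] cong: if_cong)
  ultimately show ?thesis by simp
qed

text \<open>
  Multiplying \<open>M u = 0\<close> by \<open>E k\<close> isolates the \<open>k\<close>-th component \<open>l k * E k u\<close>.
\<close>

lemma spectral_kernel:
  assumes "\<And>x y. x \<in> Y \<Longrightarrow> y \<in> Y \<Longrightarrow> M x y = (\<Sum>j\<in>I. l j * E j x y)"
  shows "mat_vec Y M u = (\<lambda>x. 0) \<longleftrightarrow> (\<forall>j\<in>I. l j = 0 \<or> mat_vec Y (E j) u = (\<lambda>x. 0))"
proof
  have M: "mat_vec Y M u = (\<lambda>x. \<Sum>j\<in>I. complex_of_real (l j) * mat_vec Y (E j) u x)"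
    by (rule mat_vec_combination[OF assms])
  {
    assume zero: "mat_vec Y M u = (\<lambda>x. 0)"
    show "\<forall>j\<in>I. l j = 0 \<or> mat_vec Y (E j) u = (\<lambda>x. 0)"
    proof
      fix k assume k: "k \<in> I"
      have "mat_vec Y (E k) (mat_vec Y M u) =
          (\<lambda>x. \<Sum>j\<in>I. complex_of_real (l j) * mat_vec Y (E k) (mat_vec Y (E j) u) x)"
        unfolding M by (rule mat_vec_sum)
      also have "\<dots> = (\<lambda>x. \<Sum>j\<in>I. if j = k then complex_of_real (l k) * mat_vec Y (E k) u x else 0)"
        using k by (intro ext sum.cong) (auto simp: E_mat_vec)
      also have "\<dots> = (\<lambda>x. complex_of_real (l k) * mat_vec Y (E k) u x)"
        using k finite_I by simp
      finally show "l k = 0 \<or> mat_vec Y (E k) u = (\<lambda>x. 0)"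
        unfolding zero by (auto simp: fun_eq_iff)
    qed
  }
  assume "\<forall>j\<in>I. l j = 0 \<or> mat_vec Y (E j) u = (\<lambda>x. 0)"
  then show "mat_vec Y M u = (\<lambda>x. 0)"
    unfolding M by (intro ext sum.neutral) auto
qed

lemma kernel_eq_spectral_space:
  assumes "\<And>x y. x \<in> Y \<Longrightarrow> y \<in> Y \<Longrightarrow> M x y = (\<Sum>j\<in>I. l j * E j x y)"
    and "\<And>j. j \<in> I \<Longrightarrow> l j = 0 \<longleftrightarrow> j \<in> S"
  shows "kernel Y M = spectral_space Y I E S"
  unfolding kernel_def spectral_space_def using spectral_kernel[OF assms(1)] assms(2) by auto

lemma span_subset_spectral_space:
  assumes "\<And>i. i \<in> K \<Longrightarrow> b i \<in> spectral_space Y I E S"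
  shows "vec_span K b \<subseteq> spectral_space Y I E S"
proof
  fix u assume "u \<in> vec_span K b"
  then obtain c where u: "u = (\<lambda>x. \<Sum>i\<in>K. c i * b i x)" by (auto simp: vec_span_def)
  have "u \<in> cvecs Y" using assms by (auto simp: u cvecs_def spectral_space_def)
  moreover have "mat_vec Y (E j) u = (\<lambda>x. 0)" if "j \<in> I - S" for j
    unfolding u mat_vec_sum using assms that
    by (intro ext sum.neutral) (auto simp: spectral_space_def)
  ultimately show "u \<in> spectral_space Y I E S" by (simp add: spectral_space_def)
qed

lemma spectral_space_subset_span:
  assumes "\<And>j z. j \<in> I \<Longrightarrow> j \<in> S \<Longrightarrow> z \<in> Y \<Longrightarrow> column Y (E j) z \<in> vec_span K b"
  shows "spectral_space Y I E S \<subseteq> vec_span K b"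
proof
  fix u assume u: "u \<in> spectral_space Y I E S"
  have "u = (\<lambda>x. \<Sum>j\<in>I. mat_vec Y (E j) u x)"
    using u by (intro spectral_decomposition) (simp add: spectral_space_def)
  also have "\<dots> = (\<lambda>x. \<Sum>j\<in>I \<inter> S. 1 * mat_vec Y (E j) u x)"
    using u finite_I
    by (intro ext sum.mono_neutral_cong_right) (auto simp: spectral_space_def)
  also have "\<dots> \<in> vec_span K b"
  proof (rule vec_span_combination)
    fix j assume "j \<in> I \<inter> S"
    then show "mat_vec Y (E j) u \<in> vec_span K b"
      unfolding mat_vec_columns by (intro vec_span_combination) (auto intro: assms)
  qed
  finally show "u \<in> vec_span K b" .
qed

text \<open>
  Distinct index sets give distinct spectral spaces, because \<open>E j\<close> fixes its own columns and is not
  zero. This is what turns equality of subspaces into equality of index sets.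
\<close>

lemma columns_in_spectral_space_iff:
  assumes "j \<in> I"
  shows "(\<forall>z\<in>Y. column Y (E j) z \<in> spectral_space Y I E S) \<longleftrightarrow> j \<in> S"
proof -
  have E_column: "mat_vec Y (E k) (column Y (E j) z) = (if k = j then column Y (E j) z else (\<lambda>x. 0))"
    if "k \<in> I" "z \<in> Y" for k z
    unfolding mat_vec_column[OF that(2)]
    using that assms by (auto simp: column_def mat_mult_def E_mult)
  show ?thesis
  proof
    assume L: "\<forall>z\<in>Y. column Y (E j) z \<in> spectral_space Y I E S"
    show "j \<in> S"
    proof (rule ccontr)
      assume "j \<notin> S"
      then have zero: "column Y (E j) z = (\<lambda>x. 0)" if "z \<in> Y" for z
        using L that assms E_column[OF assms that] by (auto simp: spectral_space_def)
      have "E j x z = 0" if "x \<in> Y" "z \<in> Y" for x z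
        using fun_cong[OF zero[OF that(2)], of x] that by (simp add: column_def)
      then show False using E_nonzero[OF assms] by (auto simp: mat_eq_def)
    qed
  next
    assume "j \<in> S"
    then show "\<forall>z\<in>Y. column Y (E j) z \<in> spectral_space Y I E S"
      using E_column by (auto simp: spectral_space_def)
  qed
qed

lemma spectral_space_eq_sum_of_eigenspaces:
  assumes S: "S \<subseteq> I"
  shows "spectral_space Y I E S =
    {u. \<exists>w. (\<forall>j\<in>S. w j \<in> col_space Y (E j)) \<and> u = (\<lambda>x. \<Sum>j\<in>S. w j x)}"
proof (intro set_eqI iffI)
  fix u assume u: "u \<in> spectral_space Y I E S"
  have "u = (\<lambda>x. \<Sum>j\<in>I. mat_vec Y (E j) u x)"
    using u by (intro spectral_decomposition) (simp add: spectral_space_def)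
  also have "\<dots> = (\<lambda>x. \<Sum>j\<in>S. mat_vec Y (E j) u x)"
    using u finite_I S
    by (intro ext sum.mono_neutral_cong_right) (auto simp: spectral_space_def)
  finally show "u \<in> {u. \<exists>w. (\<forall>j\<in>S. w j \<in> col_space Y (E j)) \<and> u = (\<lambda>x. \<Sum>j\<in>S. w j x)}"
    using u by (intro CollectI exI[of _ "\<lambda>j. mat_vec Y (E j) u"])
      (auto simp: col_space_def spectral_space_def)
next
  fix u assume "u \<in> {u. \<exists>w. (\<forall>j\<in>S. w j \<in> col_space Y (E j)) \<and> u = (\<lambda>x. \<Sum>j\<in>S. w j x)}"
  then obtain w where w: "\<And>j. j \<in> S \<Longrightarrow> w j \<in> col_space Y (E j)"
    and u: "u = (\<lambda>x. \<Sum>j\<in>S. 1 * w j x)" by auto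
  have "w j \<in> cvecs Y" if "j \<in> S" for j using w[OF that] by (auto simp: col_space_def)
  then have "u \<in> cvecs Y" by (simp add: u cvecs_def)
  moreover have "mat_vec Y (E k) u = (\<lambda>x. 0)" if "k \<in> I - S" for k
  proof -
    have "mat_vec Y (E k) (w j) = (\<lambda>x. 0)" if "j \<in> S" for j
      using w[OF that] that \<open>k \<in> I - S\<close> S by (auto simp: col_space_def E_mat_vec)
    then show ?thesis unfolding u mat_vec_sum by simp
  qed
  ultimately show "u \<in> spectral_space Y I E S" by (simp add: spectral_space_def)
qed

text \<open>
  Both sides are the orthogonal projection of \<open>Q\<close> onto the Bose--Mesner algebra. Formally, the left
  side has the same inner products with all \<open>A i\<close> as \<open>Q\<close>, hence with all \<open>E j\<close>, and these inner
  products determine its coefficients in the basis \<open>E\<close>.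
\<close>

lemma projection_in_both_bases:
  assumes "x \<in> Y" "y \<in> Y"
  shows "(\<Sum>i\<in>I. proj_coeff Y Q (A i) * A i x y) = (\<Sum>j\<in>I. proj_coeff Y Q (E j) * E j x y)"
proof -
  define R where "R = (\<lambda>x y. \<Sum>i\<in>I. proj_coeff Y Q (A i) * A i x y)"
  have RA: "mat_inner Y R (A k) = mat_inner Y Q (A k)" if k: "k \<in> I" for k
  proof -
    have "mat_inner Y R (A k) = (\<Sum>i\<in>I. proj_coeff Y Q (A i) * mat_inner Y (A i) (A k))"
      by (rule mat_inner_combination) (simp add: R_def)
    also have "\<dots> = (\<Sum>i\<in>I. if i = k then mat_inner Y Q (A k) else 0)"
      using k A_norm_pos[OF k] by (intro sum.cong) (auto simp: A_orthogonal proj_coeff_def)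
    finally show ?thesis using k finite_I by simp
  qed
  have RE: "mat_inner Y R (E j) = mat_inner Y Q (E j)" if j: "j \<in> I" for j
  proof -
    obtain c where c: "\<forall>x\<in>Y. \<forall>y\<in>Y. E j x y = (\<Sum>i\<in>I. c i * A i x y)"
      using E_in_span_A[OF j] by blast
    then have "mat_inner Y (E j) N = (\<Sum>i\<in>I. c i * mat_inner Y (A i) N)" for N
      by (intro mat_inner_combination) auto
    then show ?thesis using RA by (simp add: mat_inner_commute[of _ _ "E j"] mat_inner_commute[of _ _ "A _"])
  qed
  obtain p where p: "\<And>i x y. i \<in> I \<Longrightarrow> x \<in> Y \<Longrightarrow> y \<in> Y \<Longrightarrow> A i x y = (\<Sum>j\<in>I. p i j * E j x y)"
    using A_in_span_E by metis
  define l where "l = (\<lambda>j. \<Sum>i\<in>I. proj_coeff Y Q (A i) * p i j)"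
  have R: "R x y = (\<Sum>j\<in>I. l j * E j x y)" if "x \<in> Y" "y \<in> Y" for x y
  proof -
    have "R x y = (\<Sum>i\<in>I. \<Sum>j\<in>I. proj_coeff Y Q (A i) * p i j * E j x y)"
      unfolding R_def using that by (intro sum.cong) (auto simp: p sum_distrib_left mult.assoc)
    also have "\<dots> = (\<Sum>j\<in>I. l j * E j x y)"
      by (subst sum.swap) (simp add: l_def sum_distrib_right)
    finally show ?thesis .
  qed
  have "l k = proj_coeff Y Q (E k)" if k: "k \<in> I" for k
  proof -
    have "mat_inner Y R (E k) = (\<Sum>j\<in>I. l j * mat_inner Y (E j) (E k))"
      by (rule mat_inner_combination[OF R])
    also have "\<dots> = (\<Sum>j\<in>I. if j = k then l k * mat_inner Y (E k) (E k) else 0)"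
      using k by (intro sum.cong) (auto simp: E_orthogonal)
    finally have "mat_inner Y Q (E k) = l k * mat_inner Y (E k) (E k)"
      using k finite_I RE by simp
    then show ?thesis using E_norm_pos[OF k] by (simp add: proj_coeff_def)
  qed
  then have "(\<Sum>j\<in>I. l j * E j x y) = (\<Sum>j\<in>I. proj_coeff Y Q (E j) * E j x y)" by simp
  then show ?thesis using R[OF assms] by (simp add: R_def)
qed

text \<open>
  As \<open>E j\<close> is a symmetric idempotent, \<open>tr (Q E\<^sub>j) = tr (E\<^sub>j Q E\<^sub>j)\<close>, the sum of the quadratic
  forms of \<open>Q\<close> at the columns of \<open>E j\<close>.
\<close>

lemma mat_inner_E_eq_sum_of_forms:
  assumes j: "j \<in> I"
  shows "mat_inner Y Q (E j) = (\<Sum>z\<in>Y. \<Sum>x\<in>Y. \<Sum>y\<in>Y. E j x z * Q x y * E j y z)"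
proof -
  have "mat_inner Y Q (E j) = (\<Sum>x\<in>Y. \<Sum>y\<in>Y. \<Sum>z\<in>Y. E j x z * Q x y * E j y z)"
    unfolding mat_inner_def
  proof (intro sum.cong refl)
    fix x y assume xy: "x \<in> Y" "y \<in> Y"
    have "E j x y = (\<Sum>z\<in>Y. E j x z * E j y z)"
      using E_mult[OF j j xy] j xy by (auto simp: E_sym intro: sum.cong)
    then have "Q x y * E j x y = Q x y * (\<Sum>z\<in>Y. E j x z * E j y z)" by (rule arg_cong)
    then show "Q x y * E j x y = (\<Sum>z\<in>Y. E j x z * Q x y * E j y z)"
      by (simp add: sum_distrib_left mult_ac)
  qed
  also have "\<dots> = (\<Sum>x\<in>Y. \<Sum>z\<in>Y. \<Sum>y\<in>Y. E j x z * Q x y * E j y z)"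
    by (intro sum.cong refl sum.swap)
  also have "\<dots> = (\<Sum>z\<in>Y. \<Sum>x\<in>Y. \<Sum>y\<in>Y. E j x z * Q x y * E j y z)"
    by (rule sum.swap)
  finally show ?thesis .
qed

lemma proj_coeff_E_nonneg:
  assumes "psd_mat Y Q" "j \<in> I"
  shows "proj_coeff Y Q (E j) \<ge> 0"
  unfolding proj_coeff_def mat_inner_E_eq_sum_of_forms[OF assms(2), of Q]
  using assms E_norm_pos[OF assms(2)]
  by (intro divide_nonneg_pos
        sum_nonneg[where A = Y and f = "\<lambda>z. \<Sum>x\<in>Y. \<Sum>y\<in>Y. E j x z * Q x y * E j y z"])
     (simp_all add: psd_mat_def)

text \<open>
  A sum of nonnegative forms vanishes only if each does, and a positive semidefinite matrix kills
  its isotropic vectors.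
\<close>

lemma proj_coeff_E_eq_0_iff:
  assumes sym: "symmetric_mat Y Q" and psd: "psd_mat Y Q" and j: "j \<in> I"
  shows "proj_coeff Y Q (E j) = 0 \<longleftrightarrow> (\<forall>z\<in>Y. column Y (E j) z \<in> kernel Y Q)"
proof -
  have "proj_coeff Y Q (E j) = 0 \<longleftrightarrow>
      (\<forall>z\<in>Y. (\<Sum>x\<in>Y. \<Sum>y\<in>Y. E j x z * Q x y * E j y z) = 0)"
    unfolding proj_coeff_def mat_inner_E_eq_sum_of_forms[OF j, of Q]
    using psd finite_Y E_norm_pos[OF j]
    by (simp add: psd_mat_def sum_nonneg_eq_0_iff)
  also have "\<dots> \<longleftrightarrow> (\<forall>z\<in>Y. \<forall>x\<in>Y. (\<Sum>y\<in>Y. Q x y * E j y z) = 0)"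
  proof (intro ball_cong refl iffI)
    fix z assume "(\<Sum>x\<in>Y. \<Sum>y\<in>Y. E j x z * Q x y * E j y z) = 0"
    then show "\<forall>x\<in>Y. (\<Sum>y\<in>Y. Q x y * E j y z) = 0"
      using psd_isotropic_kernel[OF finite_Y sym psd, of "\<lambda>x. E j x z"] by auto
  next
    fix z assume "\<forall>x\<in>Y. (\<Sum>y\<in>Y. Q x y * E j y z) = 0"
    then show "(\<Sum>x\<in>Y. \<Sum>y\<in>Y. E j x z * Q x y * E j y z) = 0"
      by (simp add: mult.assoc flip: sum_distrib_left)
  qed
  also have "\<dots> \<longleftrightarrow> (\<forall>z\<in>Y. column Y (E j) z \<in> kernel Y Q)"
  proof (rule ball_cong[OF refl])
    fix z assume "z \<in> Y"
    have "column Y (mat_mult Y Q (E j)) z = (\<lambda>x. 0) \<longleftrightarrow> (\<forall>x\<in>Y. mat_mult Y Q (E j) x z = 0)"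
      by (auto simp: column_def fun_eq_iff)
    then show "(\<forall>x\<in>Y. (\<Sum>y\<in>Y. Q x y * E j y z) = 0) \<longleftrightarrow> column Y (E j) z \<in> kernel Y Q"
      unfolding kernel_def mem_Collect_eq mat_vec_column[OF \<open>z \<in> Y\<close>] by (simp add: mat_mult_def)
  qed
  finally show ?thesis .
qed

lemma psd_spectral:
  assumes M: "\<And>x y. x \<in> Y \<Longrightarrow> y \<in> Y \<Longrightarrow> M x y = (\<Sum>j\<in>I. l j * E j x y)"
    and l: "\<And>j. j \<in> I \<Longrightarrow> l j \<ge> 0"
  shows "psd_mat Y M"
  unfolding psd_mat_def
proof
  fix u :: "'a \<Rightarrow> real"
  define N where "N = (\<lambda>x y. u x * u y)"
  have EN: "mat_inner Y (E j) N = (\<Sum>z\<in>Y. (\<Sum>x\<in>Y. u x * E j x z)\<^sup>2)" if j: "j \<in> I" for j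
    unfolding mat_inner_commute[of _ "E j"] mat_inner_E_eq_sum_of_forms[OF j] N_def power2_eq_square
    by (intro sum.cong refl) (simp add: sum_product mult_ac)
  have "(\<Sum>x\<in>Y. \<Sum>y\<in>Y. u x * M x y * u y) = mat_inner Y M N"
    by (simp add: mat_inner_def N_def mult_ac)
  also have "\<dots> = (\<Sum>j\<in>I. l j * mat_inner Y (E j) N)"
    by (rule mat_inner_combination[OF M])
  also have "\<dots> \<ge> 0"
    using l by (intro sum_nonneg mult_nonneg_nonneg) (auto simp: EN intro: sum_nonneg)
  finally show "(\<Sum>x\<in>Y. \<Sum>y\<in>Y. u x * M x y * u y) \<ge> 0" .
qed

text \<open>
  Adding the constant \<open>c\<close> to all entries means adding \<open>c J\<close>, where \<open>J\<close> is the sum of all \<open>A i\<close> and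
  also \<open>|Y| E\<^sub>0\<close>.
\<close>

lemma A_combination_shift:
  assumes "x \<in> Y" "y \<in> Y"
  shows "(\<Sum>i\<in>I. f i * A i x y) + c = (\<Sum>i\<in>I. (f i + c) * A i x y)"
proof -
  have "(\<Sum>i\<in>I. c * A i x y) = c"
    using A_sum[OF assms] by (simp flip: sum_distrib_left)
  then show ?thesis by (simp add: distrib_right sum.distrib)
qed

lemma E_combination_shift:
  assumes "x \<in> Y" "y \<in> Y"
  shows "(\<Sum>j\<in>I. l j * E j x y) + c =
    (\<Sum>j\<in>I. (l j + (if j = i0 then c * real (card Y) else 0)) * E j x y)"
proof -
  have "(\<Sum>j\<in>I. (if j = i0 then c * real (card Y) else 0) * E j x y) =
        (\<Sum>j\<in>I. if j = i0 then c * real (card Y) * E i0 x y else 0)"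
    by (intro sum.cong) auto
  also have "\<dots> = c"
    using finite_I i0_in_I E_i0[OF assms] finite_Y Y_nonempty by simp
  finally show ?thesis by (simp add: distrib_right sum.distrib)
qed

text \<open>
  Here and in the next lemma \<open>S\<close> is the set of relations whose union is the graph. In the
  Bose--Mesner algebra, a matrix is a dual certificate as soon as its coefficients satisfy the
  corresponding inequalities, since an entry of the matrix is the coefficient of the relation in
  which the entry lies.
\<close>

lemma dual_certificate_of_coefficients:
  assumes MA: "\<And>x y. x \<in> Y \<Longrightarrow> y \<in> Y \<Longrightarrow> M x y = (\<Sum>i\<in>I. f i * A i x y)"
    and ME: "\<And>x y. x \<in> Y \<Longrightarrow> y \<in> Y \<Longrightarrow> M x y = (\<Sum>j\<in>I. l j * E j x y)"
    and l: "\<And>j. j \<in> I \<Longrightarrow> l j \<ge> 0"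
    and f0: "f i0 = \<beta> - 1" and f: "\<And>i. i \<in> I \<Longrightarrow> i \<notin> S \<union> {i0} \<Longrightarrow> f i \<le> - 1"
    and adj: "\<And>x y i. x \<in> Y \<Longrightarrow> y \<in> Y \<Longrightarrow> i \<in> I \<Longrightarrow> A i x y = 1 \<Longrightarrow> adj x y \<longleftrightarrow> i \<in> S"
  shows "dual_certificate Y adj \<beta> M"
  unfolding dual_certificate_def
proof (intro conjI ballI impI)
  show "symmetric_mat Y M"
    unfolding symmetric_mat_def mat_eq_def by (auto simp: ME E_sym intro!: sum.cong)
  show "psd_mat Y M" by (rule psd_spectral[OF ME l])
next
  fix x assume x: "x \<in> Y"
  show "M x x = \<beta> - 1"
    using A_combination_entry[OF x x i0_in_I, of f] A_i0[OF x x] f0 MA[OF x x] by simp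
next
  fix x y assume xy: "x \<in> Y" "y \<in> Y" and na: "x \<noteq> y \<and> \<not> adj x y"
  obtain i where i: "i \<in> I" "A i x y = 1" using relation_exists[OF xy] .
  have "i \<noteq> i0" using na i A_i0[OF xy] by auto
  moreover have "i \<notin> S" using adj[OF xy i] na by blast
  ultimately have "f i \<le> - 1" using f i by simp
  then show "M x y \<le> -1" using A_combination_entry[OF xy i] MA[OF xy] by simp
qed

text \<open>
  The coefficient of \<open>A i\<close> is the average of \<open>Q\<close> over the pairs in the \<open>i\<close>-th relation, so bounds
  on these entries carry over.
\<close>

lemma projected_certificate_coefficients:
  assumes Q: "dual_certificate Y adj \<beta> Q"
    and adj: "\<And>x y i. x \<in> Y \<Longrightarrow> y \<in> Y \<Longrightarrow> i \<in> I \<Longrightarrow> A i x y = 1 \<Longrightarrow> adj x y \<longleftrightarrow> i \<in> S"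
  shows "proj_coeff Y Q (A i0) = \<beta> - 1"
    and "i \<in> I \<Longrightarrow> i \<notin> S \<union> {i0} \<Longrightarrow> proj_coeff Y Q (A i) \<le> - 1"
proof -
  have "mat_inner Y Q (A i0) = (\<beta> - 1) * mat_inner Y (A i0) (A i0)"
    unfolding mat_inner_def sum_distrib_left
    using Q by (intro sum.cong refl) (auto simp: A_i0 dual_certificate_def)
  then show "proj_coeff Y Q (A i0) = \<beta> - 1"
    using A_norm_pos[OF i0_in_I] by (simp add: proj_coeff_def)
next
  assume i: "i \<in> I" "i \<notin> S \<union> {i0}"
  have "mat_inner Y Q (A i) \<le> (- 1) * mat_inner Y (A i) (A i)"
    unfolding mat_inner_def sum_distrib_left
  proof (intro sum_mono)
    fix x y assume xy: "x \<in> Y" "y \<in> Y"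
    show "Q x y * A i x y \<le> - 1 * (A i x y * A i x y)"
    proof (cases "A i x y = 1")
      case True
      have "\<not> adj x y" using adj[OF xy i(1) True] i(2) by blast
      moreover have "x \<noteq> y"
        using relation_unique[OF xy i0_in_I _ i(1)] A_i0[OF xy] True i(2) by auto
      ultimately show ?thesis using Q xy True by (simp add: dual_certificate_def)
    next
      case False
      then show ?thesis using A_01[OF i(1) xy] by simp
    qed
  qed
  then show "proj_coeff Y Q (A i) \<le> - 1"
    using A_norm_pos[OF i(1)] by (simp add: proj_coeff_def divide_le_eq)
qed

end

text \<open>
  The change of basis has complex coefficients a priori; their real parts work as well because both
  bases are real.
\<close>

lemma assoc_scheme_bases:
  assumes "assoc_scheme X s A" "idempotent_basis X s A E" "X \<noteq> {}"
  shows "scheme_bases X {..s} 0 A E"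
proof
  have indep: "mat_indep X {..s} E" and span: "mat_span X {..s} E = mat_span X {..s} A"
    using assms(2) by (auto simp: idempotent_basis_def)
  have member: "complexify (B i) \<in> mat_span X {..s} B" if "i \<le> s" for i and B :: "nat \<Rightarrow> 'a \<Rightarrow> 'a \<Rightarrow> real"
  proof -
    have "mat_comb {..s} (\<lambda>k. if k = i then 1 else 0) B x y = complexify (B i) x y" for x y
    proof -
      have "mat_comb {..s} (\<lambda>k. if k = i then 1 else 0) B x y =
          (\<Sum>k\<le>s. if k = i then complex_of_real (B i x y) else 0)"
        unfolding mat_comb_def by (intro sum.cong) auto
      then show ?thesis using that by (simp add: complexify_def)
    qed
    then show ?thesis unfolding mat_span_def mat_eq_def
      by (intro CollectI exI[of _ "\<lambda>k. if k = i then 1 else 0"]) simp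
  qed
  have real_coeffs: "\<exists>c. \<forall>x\<in>X. \<forall>y\<in>X. M x y = (\<Sum>j\<le>s. c j * B j x y)"
    if M: "complexify M \<in> mat_span X {..s} B" for M and B :: "nat \<Rightarrow> 'a \<Rightarrow> 'a \<Rightarrow> real"
  proof -
    obtain c where c: "\<And>x y. x \<in> X \<Longrightarrow> y \<in> X \<Longrightarrow> complexify M x y = mat_comb {..s} c B x y"
      using M by (auto simp: mat_span_def mat_eq_def)
    have "M x y = (\<Sum>j\<le>s. Re (c j) * B j x y)" if "x \<in> X" "y \<in> X" for x y
      using arg_cong[OF c[OF that], of Re] by (simp add: complexify_def mat_comb_def)
    then show ?thesis by (intro exI[of _ "\<lambda>j. Re (c j)"]) simp
  qed
  show "\<exists>c. \<forall>x\<in>X. \<forall>y\<in>X. A i x y = (\<Sum>j\<le>s. c j * E j x y)" if "i \<in> {..s}" for i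
    using member[of i A] that span by (intro real_coeffs) simp
  show "\<exists>c. \<forall>x\<in>X. \<forall>y\<in>X. E j x y = (\<Sum>i\<le>s. c i * A i x y)" if "j \<in> {..s}" for j
    using member[of j E] that span by (intro real_coeffs) simp
  show "\<not> mat_eq X (E j) (\<lambda>x y. 0)" if j: "j \<in> {..s}" for j
  proof
    assume z: "mat_eq X (E j) (\<lambda>x y. 0)"
    have "mat_eq X (mat_comb {..s} (\<lambda>k. if k = j then 1 else 0) E) (\<lambda>x y. 0)"
      using z unfolding mat_eq_def mat_comb_def by (auto intro!: sum.neutral)
    then have "\<forall>k\<in>{..s}. (if k = j then 1 else 0 :: complex) = 0"
      using indep[unfolded mat_indep_def, rule_format, of "\<lambda>k. if k = j then 1 else 0"] by blast
    then show False using j by (metis zero_neq_one)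
  qed
  show "(\<Sum>z\<in>X. E j x z * E k z y) = (if j = k then E j x y else 0)"
    if "j \<in> {..s}" "k \<in> {..s}" "x \<in> X" "y \<in> X" for j k x y
    using assms(2) that by (auto simp: idempotent_basis_def mat_eq_def mat_mult_def)
qed (use assms in \<open>auto simp: assoc_scheme_def idempotent_basis_def symmetric_mat_def mat_eq_def mat_id_def\<close>)

section \<open>Tensor powers\<close>

lemma tuples_nth: "x \<in> tuples m X \<Longrightarrow> k \<in> {1..m} \<Longrightarrow> x k \<in> X"
  by (auto simp: tuples_def)

lemma tuples_eq_iff:
  "x \<in> tuples m X \<Longrightarrow> y \<in> tuples m X \<Longrightarrow> x = y \<longleftrightarrow> (\<forall>k\<in>{1..m}. x k = y k)"
  unfolding tuples_def by (blast intro: PiE_ext)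

lemma tuples_restrict: "(\<And>k. k \<in> {1..m} \<Longrightarrow> g k \<in> X) \<Longrightarrow> restrict g {1..m} \<in> tuples m X"
  by (auto simp: tuples_def)

lemma finite_tuples: "finite X \<Longrightarrow> finite (tuples m X)"
  by (simp add: tuples_def finite_PiE)

lemma card_tuples: "finite X \<Longrightarrow> card (tuples m X) = card X ^ m"
  by (simp add: tuples_def card_PiE)

lemma prod_sum_tuples:
  fixes g :: "nat \<Rightarrow> 'a \<Rightarrow> 'b::comm_semiring_1"
  assumes "finite X"
  shows "(\<Sum>x\<in>tuples m X. \<Prod>k\<in>{1..m}. g k (x k)) = (\<Prod>k\<in>{1..m}. \<Sum>a\<in>X. g k a)"
  unfolding tuples_def by (rule prod_sum_PiE[symmetric]) (simp_all add: assms)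

lemma prod_if_zero:
  fixes g :: "nat \<Rightarrow> 'b::comm_semiring_1"
  assumes "finite K"
  shows "(\<Prod>k\<in>K. if Q k then g k else 0) = (if \<forall>k\<in>K. Q k then \<Prod>k\<in>K. g k else 0)"
proof (cases "\<forall>k\<in>K. Q k")
  case False
  then have "(\<Prod>k\<in>K. if Q k then g k else 0) = 0" using assms by (intro prod_zero) auto
  then show ?thesis using False by (simp only: if_False)
qed simp

lemma zero_index_tuple: "zero_index m \<in> tuples m {..s}"
  unfolding zero_index_def by (rule tuples_restrict) simp

text \<open>
  Each property of the bases is a statement about sums over \<open>X\<close> or over \<open>{..s}\<close> that holds in every
  coordinate, and \<open>prod_sum_tuples\<close> multiplies these coordinate sums to a sum over tuples.
\<close>

lemma tensor_power_scheme_bases: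
  assumes "scheme_bases X {..s} 0 A E"
  shows "scheme_bases (tuples m X) (tuples m {..s}) (zero_index m) (tensor_mat m A) (tensor_mat m E)"
proof
  interpret scheme_bases X "{..s}" 0 A E by fact
  have nth: "x k \<in> X" if "x \<in> tuples m X" "k \<in> {1..m}" for x k
    using that by (rule tuples_nth)
  have idx: "i k \<in> {..s}" if "i \<in> tuples m {..s}" "k \<in> {1..m}" for i k
    using that by (rule tuples_nth)
  obtain x0 where x0: "x0 \<in> X" using Y_nonempty by blast
  show "finite (tuples m X)" "finite (tuples m {..s})"
    by (simp_all add: finite_tuples finite_Y)
  show "tuples m X \<noteq> {}" using tuples_restrict[of m "\<lambda>_. x0" X] x0 by auto
  show "zero_index m \<in> tuples m {..s}" by (rule zero_index_tuple)
  show "tensor_mat m A i x y \<in> {0, 1}"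
    if "i \<in> tuples m {..s}" "x \<in> tuples m X" "y \<in> tuples m X" for i x y
  proof (cases "\<forall>k\<in>{1..m}. A (i k) (x k) (y k) = 1")
    case False
    then obtain k where k: "k \<in> {1..m}" "A (i k) (x k) (y k) \<noteq> 1" by blast
    then have "A (i k) (x k) (y k) = 0"
      using A_01[OF idx[OF that(1) k(1)] nth[OF that(2) k(1)] nth[OF that(3) k(1)]] by simp
    then have "tensor_mat m A i x y = 0" unfolding tensor_mat_def using k(1) by (intro prod_zero) auto
    then show ?thesis by simp
  qed (simp add: tensor_mat_def)
  have nonzero: "\<not> mat_eq (tuples m X) (tensor_mat m B i) (\<lambda>x y. 0)"
    if "\<And>a. a \<in> {..s} \<Longrightarrow> \<not> mat_eq X (B a) (\<lambda>x y. 0)" "i \<in> tuples m {..s}"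
    for B :: "nat \<Rightarrow> 'a \<Rightarrow> 'a \<Rightarrow> real" and i
  proof -
    have "\<forall>k\<in>{1..m}. \<exists>x y. x \<in> X \<and> y \<in> X \<and> B (i k) x y \<noteq> 0"
      using that(1)[OF idx[OF that(2)]] unfolding mat_eq_def by blast
    then obtain f g where fg: "\<forall>k\<in>{1..m}. f k \<in> X \<and> g k \<in> X \<and> B (i k) (f k) (g k) \<noteq> 0"
      by metis
    then have "restrict f {1..m} \<in> tuples m X" "restrict g {1..m} \<in> tuples m X"
      by (blast intro: tuples_restrict)+
    moreover have "tensor_mat m B i (restrict f {1..m}) (restrict g {1..m}) \<noteq> 0"
      using fg by (simp add: tensor_mat_def)
    ultimately show ?thesis by (auto simp: mat_eq_def)
  qed
  show "\<not> mat_eq (tuples m X) (tensor_mat m A i) (\<lambda>x y. 0)" if "i \<in> tuples m {..s}" for i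
    using A_nonzero that by (rule nonzero)
  show "\<not> mat_eq (tuples m X) (tensor_mat m E j) (\<lambda>x y. 0)" if "j \<in> tuples m {..s}" for j
    using E_nonzero that by (rule nonzero)
  show "(\<Sum>i\<in>tuples m {..s}. tensor_mat m A i x y) = 1"
    if "x \<in> tuples m X" "y \<in> tuples m X" for x y
  proof -
    have "(\<Sum>i\<in>tuples m {..s}. tensor_mat m A i x y) = (\<Prod>k\<in>{1..m}. \<Sum>a\<le>s. A a (x k) (y k))"
      unfolding tensor_mat_def by (rule prod_sum_tuples) simp
    also have "\<dots> = 1" using A_sum nth that by (intro prod.neutral) blast
    finally show ?thesis .
  qed
  show "(\<Sum>j\<in>tuples m {..s}. tensor_mat m E j x y) = (if x = y then 1 else 0)"
    if "x \<in> tuples m X" "y \<in> tuples m X" for x y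
  proof -
    have "(\<Sum>j\<in>tuples m {..s}. tensor_mat m E j x y) = (\<Prod>k\<in>{1..m}. \<Sum>a\<le>s. E a (x k) (y k))"
      unfolding tensor_mat_def by (rule prod_sum_tuples) simp
    also have "\<dots> = (\<Prod>k\<in>{1..m}. if x k = y k then 1 else 0)"
      using E_sum nth that by (intro prod.cong) blast+
    finally show ?thesis using tuples_eq_iff[OF that] by (simp add: prod_if_zero)
  qed
  show "tensor_mat m A (zero_index m) x y = (if x = y then 1 else 0)"
    if "x \<in> tuples m X" "y \<in> tuples m X" for x y
  proof -
    have "tensor_mat m A (zero_index m) x y = (\<Prod>k\<in>{1..m}. if x k = y k then 1 else 0)"
      unfolding tensor_mat_def zero_index_def using A_i0 nth that by (intro prod.cong) auto
    then show ?thesis using tuples_eq_iff[OF that] by (simp add: prod_if_zero)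
  qed
  show "tensor_mat m E j x y = tensor_mat m E j y x"
    if "j \<in> tuples m {..s}" "x \<in> tuples m X" "y \<in> tuples m X" for j x y
    unfolding tensor_mat_def using that by (intro prod.cong refl E_sym idx nth)
  show "(\<Sum>z\<in>tuples m X. tensor_mat m E i x z * tensor_mat m E j z y) =
      (if i = j then tensor_mat m E i x y else 0)"
    if ij: "i \<in> tuples m {..s}" "j \<in> tuples m {..s}" and xy: "x \<in> tuples m X" "y \<in> tuples m X"
    for i j x y
  proof -
    have "(\<Sum>z\<in>tuples m X. tensor_mat m E i x z * tensor_mat m E j z y) =
        (\<Prod>k\<in>{1..m}. \<Sum>a\<in>X. E (i k) (x k) a * E (j k) a (y k))"
      unfolding tensor_mat_def prod.distrib[symmetric] by (rule prod_sum_tuples[OF finite_Y])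
    also have "\<dots> = (\<Prod>k\<in>{1..m}. if i k = j k then E (i k) (x k) (y k) else 0)"
      using ij xy by (intro prod.cong refl E_mult idx nth)
    finally show ?thesis using tuples_eq_iff[OF ij] by (simp add: prod_if_zero tensor_mat_def)
  qed
  show "tensor_mat m E (zero_index m) x y = 1 / real (card (tuples m X))"
    if "x \<in> tuples m X" "y \<in> tuples m X" for x y
  proof -
    have "tensor_mat m E (zero_index m) x y = (\<Prod>k\<in>{1..m}. 1 / real (card X))"
      unfolding tensor_mat_def zero_index_def using E_i0 nth that by (intro prod.cong) auto
    then show ?thesis by (simp add: card_tuples finite_Y power_divide)
  qed
  have span: "\<exists>c. \<forall>x\<in>tuples m X. \<forall>y\<in>tuples m X.
        tensor_mat m B i x y = (\<Sum>j\<in>tuples m {..s}. c j * tensor_mat m C j x y)"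
    if BC: "\<And>a. a \<in> {..s} \<Longrightarrow> \<exists>c. \<forall>x\<in>X. \<forall>y\<in>X. B a x y = (\<Sum>b\<le>s. c b * C b x y)"
      and i: "i \<in> tuples m {..s}"
    for B C :: "nat \<Rightarrow> 'a \<Rightarrow> 'a \<Rightarrow> real" and i
  proof -
    obtain p where p: "\<And>a x y. a \<in> {..s} \<Longrightarrow> x \<in> X \<Longrightarrow> y \<in> X \<Longrightarrow>
        B a x y = (\<Sum>b\<le>s. p a b * C b x y)"
      using BC by metis
    have "tensor_mat m B i x y =
        (\<Sum>j\<in>tuples m {..s}. (\<Prod>k\<in>{1..m}. p (i k) (j k)) * tensor_mat m C j x y)"
      if "x \<in> tuples m X" "y \<in> tuples m X" for x y
    proof -
      have "tensor_mat m B i x y = (\<Prod>k\<in>{1..m}. \<Sum>b\<le>s. p (i k) b * C b (x k) (y k))"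
        unfolding tensor_mat_def using that i by (intro prod.cong refl p idx nth)
      also have "\<dots> = (\<Sum>j\<in>tuples m {..s}. \<Prod>k\<in>{1..m}. p (i k) (j k) * C (j k) (x k) (y k))"
        by (rule prod_sum_tuples[symmetric]) simp
      finally show ?thesis by (simp add: prod.distrib tensor_mat_def)
    qed
    then show ?thesis by (intro exI[of _ "\<lambda>j. \<Prod>k\<in>{1..m}. p (i k) (j k)"]) simp
  qed
  show "\<exists>c. \<forall>x\<in>tuples m X. \<forall>y\<in>tuples m X.
        tensor_mat m A i x y = (\<Sum>j\<in>tuples m {..s}. c j * tensor_mat m E j x y)"
    if "i \<in> tuples m {..s}" for i
    using A_in_span_E that by (rule span)
  show "\<exists>c. \<forall>x\<in>tuples m X. \<forall>y\<in>tuples m X.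
        tensor_mat m E j x y = (\<Sum>i\<in>tuples m {..s}. c i * tensor_mat m A i x y)"
    if "j \<in> tuples m {..s}" for j
    using E_in_span_A that by (rule span)
qed

lemma derived_adj_iff:
  assumes "scheme_bases X {..s} 0 A E" "\<Gamma> \<subseteq> {..s}"
    and "x \<in> X" "y \<in> X" "i \<in> {..s}" "A i x y = 1"
  shows "derived_adj A \<Gamma> x y \<longleftrightarrow> i \<in> \<Gamma>"
proof -
  interpret scheme_bases X "{..s}" 0 A E by fact
  have "(\<Sum>k\<in>\<Gamma>. A k x y) = (\<Sum>k\<in>\<Gamma>. if k = i then 1 else 0)"
    using relation_unique[OF assms(3-6)] assms(2,6) by (intro sum.cong) auto
  also have "\<dots> = (if i \<in> \<Gamma> then 1 else 0)"
    using finite_subset[OF assms(2)] by simp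
  finally show ?thesis by (simp add: derived_adj_def)
qed

lemma power_adj_iff:
  assumes sch: "scheme_bases X {..s} 0 A E" and \<Gamma>: "\<Gamma> \<subseteq> {..s}"
    and x: "x \<in> tuples m X" and y: "y \<in> tuples m X" and i: "i \<in> tuples m {..s}"
    and one: "tensor_mat m A i x y = 1"
  shows "power_adj m (derived_adj A \<Gamma>) x y \<longleftrightarrow> i \<in> tuples m \<Gamma>"
proof -
  interpret scheme_bases X "{..s}" 0 A E by fact
  have "A (i k) (x k) (y k) = 1" if k: "k \<in> {1..m}" for k
  proof -
    have "A (i k) (x k) (y k) \<noteq> 0"
    proof
      assume "A (i k) (x k) (y k) = 0"
      then have "tensor_mat m A i x y = 0" unfolding tensor_mat_def using k by (intro prod_zero) auto
      then show False using one by simp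
    qed
    then show ?thesis
      using A_01[OF tuples_nth[OF i k] tuples_nth[OF x k] tuples_nth[OF y k]] by simp
  qed
  then have "power_adj m (derived_adj A \<Gamma>) x y \<longleftrightarrow> (\<forall>k\<in>{1..m}. i k \<in> \<Gamma>)"
    unfolding power_adj_def
    using derived_adj_iff[OF sch \<Gamma> tuples_nth[OF x] tuples_nth[OF y] tuples_nth[OF i]] by auto
  also have "\<dots> \<longleftrightarrow> i \<in> tuples m \<Gamma>" using i by (auto simp: tuples_def PiE_iff)
  finally show ?thesis .
qed

lemma tensor_mat_vec:
  assumes "finite X"
  shows "mat_vec (tuples m X) (tensor_mat m E j) (tensor_vec m X w) =
    tensor_vec m X (\<lambda>k. mat_vec X (E (j k)) (w k))"
proof
  fix x
  show "mat_vec (tuples m X) (tensor_mat m E j) (tensor_vec m X w) x =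
    tensor_vec m X (\<lambda>k. mat_vec X (E (j k)) (w k)) x"
  proof (cases "x \<in> tuples m X")
    case True
    have "(\<Sum>y\<in>tuples m X. complex_of_real (tensor_mat m E j x y) * tensor_vec m X w y) =
        (\<Sum>y\<in>tuples m X. \<Prod>k\<in>{1..m}. complex_of_real (E (j k) (x k) (y k)) * w k (y k))"
      by (intro sum.cong) (auto simp: tensor_vec_def tensor_mat_def prod.distrib)
    also have "\<dots> = (\<Prod>k\<in>{1..m}. \<Sum>a\<in>X. complex_of_real (E (j k) (x k) a) * w k a)"
      by (rule prod_sum_tuples[OF assms])
    also have "\<dots> = (\<Prod>k\<in>{1..m}. mat_vec X (E (j k)) (w k) (x k))"
      using tuples_nth[OF True] by (intro prod.cong refl) (simp add: mat_vec_def)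
    finally show ?thesis using True by (simp add: tensor_vec_def mat_vec_def)
  qed (simp add: tensor_vec_def mat_vec_def)
qed

lemma tensor_column:
  assumes "z \<in> tuples m X"
  shows "column (tuples m X) (tensor_mat m E j) z = tensor_vec m X (\<lambda>k. column X (E (j k)) (z k))"
proof
  fix x
  show "column (tuples m X) (tensor_mat m E j) z x =
      tensor_vec m X (\<lambda>k. column X (E (j k)) (z k)) x"
  proof (cases "x \<in> tuples m X")
    case True
    then have "(\<Prod>k\<in>{1..m}. complex_of_real (E (j k) (x k) (z k))) =
        (\<Prod>k\<in>{1..m}. column X (E (j k)) (z k) (x k))"
      using tuples_nth[OF True] by (intro prod.cong refl) (simp add: column_def)
    then show ?thesis using True by (simp add: column_def tensor_vec_def tensor_mat_def)
  qed (simp add: column_def tensor_vec_def)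
qed

lemma tensor_vec_zero:
  assumes "k \<in> {1..m}" "w k = (\<lambda>x. 0)"
  shows "tensor_vec m X w = (\<lambda>x. 0)"
proof
  fix x
  have "(\<Prod>k\<in>{1..m}. w k (x k)) = 0"
    using assms by (intro prod_zero bexI[of _ k]) simp_all
  then show "tensor_vec m X w x = 0" by (simp add: tensor_vec_def)
qed

section \<open>The incidence space and its spectral description\<close>

lemma vec_span_add_scaled:
  assumes "u \<in> vec_span I b" "w \<in> vec_span I b"
  shows "(\<lambda>x. u x + a * w x) \<in> vec_span I b"
proof -
  obtain c d where "u = (\<lambda>x. \<Sum>i\<in>I. c i * b i x)" "w = (\<lambda>x. \<Sum>i\<in>I. d i * b i x)"
    using assms by (auto simp: vec_span_def)
  then have "(\<lambda>x. u x + a * w x) = (\<lambda>x. \<Sum>i\<in>I. (c i + a * d i) * b i x)"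
    by (simp add: distrib_right sum.distrib sum_distrib_left mult.assoc)
  then show ?thesis unfolding vec_span_def by (intro CollectI exI[of _ "\<lambda>i. c i + a * d i"])
qed

lemma spectral_space_add_scaled:
  assumes "u \<in> spectral_space Y I E S" "w \<in> spectral_space Y I E S"
  shows "(\<lambda>x. u x + a * w x) \<in> spectral_space Y I E S"
proof -
  have "mat_vec Y M (\<lambda>x. u x + a * w x) = (\<lambda>x. mat_vec Y M u x + a * mat_vec Y M w x)" for M
    by (auto simp: mat_vec_def fun_eq_iff distrib_left sum.distrib sum_distrib_left mult_ac)
  then show ?thesis using assms by (simp add: spectral_space_def cvecs_def)
qed

text \<open>
  A space containing the constants is the direct sum of the constants and its mean-zero part. This
  lets one pass from \<open>U = \<L> \<inter> 1\<^sup>\<bottom>\<close>, in which compatibility is phrased, to \<open>\<L>\<close> itself.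
\<close>

lemma eq_if_mean_zero_parts_eq:
  assumes fin: "finite X" and ne: "X \<noteq> {}"
    and V1: "ones X \<in> V" and Vadd: "\<And>u a. u \<in> V \<Longrightarrow> (\<lambda>x. u x + a * ones X x) \<in> V"
    and W1: "ones X \<in> W" and Wadd: "\<And>u a. u \<in> W \<Longrightarrow> (\<lambda>x. u x + a * ones X x) \<in> W"
    and eq: "{u \<in> V. (\<Sum>x\<in>X. u x) = 0} = {u \<in> W. (\<Sum>x\<in>X. u x) = 0}"
  shows "V = W"
proof -
  have sub: "V' \<subseteq> W'"
    if "\<And>u a. u \<in> V' \<Longrightarrow> (\<lambda>x. u x + a * ones X x) \<in> V'"
      "\<And>u a. u \<in> W' \<Longrightarrow> (\<lambda>x. u x + a * ones X x) \<in> W'"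
      "{u \<in> V'. (\<Sum>x\<in>X. u x) = 0} = {u \<in> W'. (\<Sum>x\<in>X. u x) = 0}" for V' W'
  proof
    fix u assume u: "u \<in> V'"
    define a where "a = (\<Sum>x\<in>X. u x) / of_nat (card X)"
    define v where "v = (\<lambda>x. u x + (- a) * ones X x)"
    have "(\<Sum>x\<in>X. ones X x) = of_nat (card X)" by (simp add: ones_def)
    then have "(\<Sum>x\<in>X. v x) = (\<Sum>x\<in>X. u x) + (- a) * of_nat (card X)"
      unfolding v_def sum.distrib sum_distrib_left[symmetric] by simp
    then have "(\<Sum>x\<in>X. v x) = 0" using fin ne by (simp add: a_def)
    moreover have "v \<in> V'" unfolding v_def by (rule that(1)[OF u])
    ultimately have "v \<in> W'" using that(3) by blast
    then have "(\<lambda>x. v x + a * ones X x) \<in> W'" by (rule that(2))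
    then show "u \<in> W'" by (simp add: v_def)
  qed
  show ?thesis using sub[OF Vadd Wadd eq] sub[OF Wadd Vadd eq[symmetric]] by blast
qed

lemma sum_chi:
  assumes "disjointness_rep X adj P r T" "x \<in> X"
  shows "(\<Sum>p\<in>P. chi X T p x) = of_nat r"
proof -
  have "(\<Sum>p\<in>P. chi X T p x) = (\<Sum>p\<in>P. of_bool (p \<in> T x))"
    using assms(2) by (intro sum.cong) (auto simp: chi_def)
  also have "\<dots> = of_nat (card (P \<inter> {p. p \<in> T x}))"
    using assms(1) by (subst sum_of_bool_eq) (auto simp: disjointness_rep_def)
  also have "P \<inter> {p. p \<in> T x} = T x" using assms by (auto simp: disjointness_rep_def)
  finally show ?thesis using assms by (simp add: disjointness_rep_def)
qed

text \<open>
  Every point lies in \<open>r\<close> of the supports, so the incidence vectors sum to \<open>r\<close> times the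
  all-ones vector.
\<close>

lemma ones_in_incidence_space:
  assumes rep: "disjointness_rep X adj P r T"
  shows "ones X \<in> incidence_space X P T"
proof -
  have "ones X x = (\<Sum>p\<in>P. (1 / of_nat r) * chi X T p x)" for x
  proof (cases "x \<in> X")
    case True
    have "(\<Sum>p\<in>P. (1 / of_nat r) * chi X T p x) = (1 / of_nat r) * of_nat r"
      using sum_chi[OF rep True] by (simp only: sum_distrib_left[symmetric])
    then show ?thesis using True rep by (simp add: ones_def disjointness_rep_def)
  qed (simp add: ones_def chi_def)
  then have "ones X = (\<lambda>x. \<Sum>p\<in>P. (1 / of_nat r) * chi X T p x)" by blast
  then show ?thesis unfolding incidence_space_def vec_span_def
    by (intro CollectI exI[of _ "\<lambda>p. 1 / of_nat r"])
qed

context scheme_bases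
begin

lemma E_i0_mat_vec: "mat_vec Y (E i0) u = (\<lambda>x. (\<Sum>y\<in>Y. u y) / of_nat (card Y) * ones Y x)"
proof
  fix x
  show "mat_vec Y (E i0) u x = (\<Sum>y\<in>Y. u y) / of_nat (card Y) * ones Y x"
  proof (cases "x \<in> Y")
    case True
    then have "mat_vec Y (E i0) u x = (\<Sum>y\<in>Y. u y / of_nat (card Y))"
      by (simp add: mat_vec_def E_i0)
    then show ?thesis using True by (simp add: ones_def sum_divide_distrib)
  qed (simp add: mat_vec_def ones_def)
qed

lemma E_mat_vec_ones: "j \<in> I \<Longrightarrow> j \<noteq> i0 \<Longrightarrow> mat_vec Y (E j) (ones Y) = (\<lambda>x. 0)"
proof -
  assume j: "j \<in> I" "j \<noteq> i0"
  have "mat_vec Y (E i0) (ones Y) = ones Y"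
    using finite_Y Y_nonempty by (simp add: E_i0_mat_vec ones_def fun_eq_iff)
  then show ?thesis using E_mat_vec[OF j(1) i0_in_I, of "ones Y"] j(2) by simp
qed

lemma ones_in_spectral_space: "i0 \<in> S \<Longrightarrow> ones Y \<in> spectral_space Y I E S"
  using E_mat_vec_ones by (auto simp: spectral_space_def cvecs_def ones_def)

lemma E_i0_mat_vec_eq_0_iff: "mat_vec Y (E i0) u = (\<lambda>x. 0) \<longleftrightarrow> (\<Sum>y\<in>Y. u y) = 0"
  using finite_Y Y_nonempty by (auto simp: E_i0_mat_vec ones_def fun_eq_iff)

end

text \<open>
  Passing from mean-zero vectors to all of \<open>\<L>\<close> adds the index \<open>0\<close>, whose eigenspace is the
  constants.
\<close>

lemma scheme_compatible_iff:
  assumes sch: "scheme_bases X {..s} 0 A E" and rep: "disjointness_rep X adj P r T"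
  shows "scheme_compatible X s E P T \<Lambda> \<longleftrightarrow>
    \<Lambda> \<subseteq> {1..s} \<and> incidence_space X P T = spectral_space X {..s} E (insert 0 \<Lambda>)"
proof (cases "\<Lambda> \<subseteq> {1..s}")
  case True
  interpret scheme_bases X "{..s}" 0 A E by (rule sch)
  let ?W = "spectral_space X {..s} E (insert 0 \<Lambda>)"
  have "{..s} - \<Lambda> = insert 0 ({..s} - insert 0 \<Lambda>)" using True by auto
  then have W0: "spectral_space X {..s} E \<Lambda> = {u \<in> ?W. (\<Sum>x\<in>X. u x) = 0}"
    unfolding spectral_space_def by (auto simp: E_i0_mat_vec_eq_0_iff)
  have "\<Lambda> \<subseteq> {..s}" using True by auto
  then have compat: "scheme_compatible X s E P T \<Lambda> \<longleftrightarrow>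
      {u \<in> incidence_space X P T. (\<Sum>x\<in>X. u x) = 0} = {u \<in> ?W. (\<Sum>x\<in>X. u x) = 0}"
    using True unfolding scheme_compatible_def incidence_perp_def W0[symmetric]
    by (simp add: spectral_space_eq_sum_of_eigenspaces)
  have "incidence_space X P T = ?W"
    if "{u \<in> incidence_space X P T. (\<Sum>x\<in>X. u x) = 0} = {u \<in> ?W. (\<Sum>x\<in>X. u x) = 0}"
  proof (rule eq_if_mean_zero_parts_eq[OF finite_Y Y_nonempty _ _ _ _ that])
    show "ones X \<in> incidence_space X P T" by (rule ones_in_incidence_space[OF rep])
    then show "(\<lambda>x. u x + a * ones X x) \<in> incidence_space X P T"
      if "u \<in> incidence_space X P T" for u a
      using that unfolding incidence_space_def by (intro vec_span_add_scaled)
    show "ones X \<in> ?W" by (rule ones_in_spectral_space) simp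
    then show "(\<lambda>x. u x + a * ones X x) \<in> ?W" if "u \<in> ?W" for u a
      using that by (intro spectral_space_add_scaled)
  qed
  then show ?thesis using compat True by auto
qed (simp add: scheme_compatible_def)

lemma index_power_iff:
  assumes "m \<ge> 1"
  shows "j \<in> index_power m \<Lambda> \<longleftrightarrow> (\<exists>i\<in>{1..m}. \<exists>a\<in>insert 0 \<Lambda>. j = unit_index m i a)"
proof -
  have "unit_index m i 0 = zero_index m" for i by (auto simp: unit_index_def zero_index_def)
  moreover have "1 \<in> {1..m}" using assms by simp
  ultimately show ?thesis unfolding index_power_def by fastforce
qed

text \<open>
  For the inclusion from left to right, \<open>E\<^sub>j\<close> applied to a generator
  \<open>1 \<otimes> \<dots> \<otimes> \<chi>\<^sub>p \<otimes> \<dots> \<otimes> 1\<close> factors over the coordinates. A nonzero index in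
  another coordinate than that of \<open>\<chi>\<^sub>p\<close> kills a factor \<open>1\<close>, and an index outside
  \<open>\<Lambda> \<union> {0}\<close> in the coordinate of \<open>\<chi>\<^sub>p\<close> kills \<open>\<chi>\<^sub>p\<close>; what is left are the indices in \<open>\<Lambda>\<^bsup>[m]\<^esup>\<close>.
  For the other inclusion, a column of \<open>E\<^sub>j\<close> with \<open>j\<close> supported in coordinate \<open>i\<close> is a column of
  some \<open>E\<^sub>a\<close>, \<open>a \<in> \<Lambda> \<union> {0}\<close>, in that coordinate, and constant in the others.
\<close>

lemma incidence_power_eq_spectral_space:
  assumes sch: "scheme_bases X {..s} 0 A E" and fin: "finite P" and m: "m \<ge> 1"
    and L: "incidence_space X P T = spectral_space X {..s} E (insert 0 \<Lambda>)"
  shows "incidence_power m X P T =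
    spectral_space (tuples m X) (tuples m {..s}) (tensor_mat m E) (index_power m \<Lambda>)"
proof -
  interpret scheme_bases X "{..s}" 0 A E by (rule sch)
  interpret pw: scheme_bases "tuples m X" "tuples m {..s}" "zero_index m" "tensor_mat m A" "tensor_mat m E"
    by (rule tensor_power_scheme_bases[OF sch])
  define b where "b = (\<lambda>(i, p). tensor_vec m X (\<lambda>k. if k = i then chi X T p else ones X))"
  have b_entry: "b (i, p) x = chi X T p (x i)" if "i \<in> {1..m}" "x \<in> tuples m X" for i p x
  proof -
    have "(\<Prod>k\<in>{1..m}. (if k = i then chi X T p else ones X) (x k)) =
        chi X T p (x i) * (\<Prod>k\<in>{1..m} - {i}. ones X (x k))"
      using that(1) by (simp add: prod.remove)
    also have "(\<Prod>k\<in>{1..m} - {i}. ones X (x k)) = 1"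
      using tuples_nth[OF that(2)] by (intro prod.neutral) (simp add: ones_def)
    finally show ?thesis using that(2) by (simp add: b_def tensor_vec_def)
  qed
  have "vec_span ({1..m} \<times> P) b \<subseteq>
      spectral_space (tuples m X) (tuples m {..s}) (tensor_mat m E) (index_power m \<Lambda>)"
  proof (rule pw.span_subset_spectral_space)
    fix q assume "q \<in> {1..m} \<times> P"
    then obtain i p where q: "q = (i, p)" and i: "i \<in> {1..m}" and p: "p \<in> P" by blast
    define w where "w = (\<lambda>k. if k = i then chi X T p else ones X)"
    have bq: "b q = tensor_vec m X w" by (simp add: b_def q w_def)
    have "mat_vec (tuples m X) (tensor_mat m E j) (b q) = (\<lambda>x. 0)"
      if j: "j \<in> tuples m {..s}" and jn: "j \<notin> index_power m \<Lambda>" for j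
    proof -
      have "\<exists>k\<in>{1..m}. mat_vec X (E (j k)) (w k) = (\<lambda>x. 0)"
      proof (cases "\<exists>k\<in>{1..m}. k \<noteq> i \<and> j k \<noteq> 0")
        case True
        then obtain k where k: "k \<in> {1..m}" "k \<noteq> i" "j k \<noteq> 0" by blast
        then show ?thesis using E_mat_vec_ones[OF tuples_nth[OF j k(1)]]
          by (intro bexI[of _ k]) (auto simp: w_def)
      next
        case False
        have "unit_index m i (j i) \<in> tuples m {..s}"
          unfolding unit_index_def by (rule tuples_restrict) (use tuples_nth[OF j i] in auto)
        then have "j = unit_index m i (j i)"
          using False j by (subst tuples_eq_iff[OF j]) (auto simp: unit_index_def)
        then have "j i \<notin> insert 0 \<Lambda>" using jn i unfolding index_power_iff[OF m] by blast
        moreover have "chi X T p \<in> spectral_space X {..s} E (insert 0 \<Lambda>)"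
          unfolding L[symmetric] incidence_space_def by (rule vec_span_generator[OF fin p])
        ultimately have "mat_vec X (E (j i)) (chi X T p) = (\<lambda>x. 0)"
          using tuples_nth[OF j i] by (auto simp: spectral_space_def)
        then show ?thesis using i by (intro bexI[of _ i]) (auto simp: w_def)
      qed
      then show ?thesis
        unfolding bq tensor_mat_vec[OF finite_Y] by (auto intro: tensor_vec_zero)
    qed
    moreover have "b q \<in> cvecs (tuples m X)" by (simp add: bq cvecs_def tensor_vec_def)
    ultimately show "b q \<in> spectral_space (tuples m X) (tuples m {..s}) (tensor_mat m E) (index_power m \<Lambda>)"
      by (simp add: spectral_space_def)
  qed
  moreover have "spectral_space (tuples m X) (tuples m {..s}) (tensor_mat m E) (index_power m \<Lambda>) \<subseteq>
      vec_span ({1..m} \<times> P) b"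
  proof (rule pw.spectral_space_subset_span)
    fix j z assume j: "j \<in> tuples m {..s}" and jI: "j \<in> index_power m \<Lambda>" and z: "z \<in> tuples m X"
    obtain i a where i: "i \<in> {1..m}" and a: "a \<in> insert 0 \<Lambda>" and ju: "j = unit_index m i a"
      using jI unfolding index_power_iff[OF m] by blast
    have ja: "j i = a" using i by (simp add: ju unit_index_def)
    have "a \<in> {..s}" using tuples_nth[OF j i] ja by simp
    then have "column X (E a) (z i) \<in> spectral_space X {..s} E (insert 0 \<Lambda>)"
      using columns_in_spectral_space_iff a tuples_nth[OF z i] by blast
    then obtain c where c: "column X (E a) (z i) = (\<lambda>x. \<Sum>p\<in>P. c p * chi X T p x)"
      unfolding L[symmetric] incidence_space_def vec_span_def by blast
    \<comment> \<open>Each of the \<open>m - 1\<close> coordinates other than \<open>i\<close> contributes an entry of \<open>E 0 = J / |X|\<close>.\<close>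
    define d :: complex where "d = (1 / of_nat (card X)) ^ (m - 1)"
    have "column (tuples m X) (tensor_mat m E j) z = (\<lambda>x. \<Sum>p\<in>P. (c p * d) * b (i, p) x)"
    proof
      fix x
      show "column (tuples m X) (tensor_mat m E j) z x = (\<Sum>p\<in>P. (c p * d) * b (i, p) x)"
      proof (cases "x \<in> tuples m X")
        case True
        have "(\<Prod>k\<in>{1..m}. column X (E (j k)) (z k) (x k)) =
            column X (E a) (z i) (x i) * (\<Prod>k\<in>{1..m} - {i}. column X (E (j k)) (z k) (x k))"
          using i ja by (simp add: prod.remove)
        also have "(\<Prod>k\<in>{1..m} - {i}. column X (E (j k)) (z k) (x k)) =
            (\<Prod>k\<in>{1..m} - {i}. 1 / of_nat (card X))"
          using tuples_nth[OF True] tuples_nth[OF z]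
          by (intro prod.cong) (auto simp: column_def ju unit_index_def E_i0)
        also have "\<dots> = d" using i by (simp add: d_def card_Diff_singleton)
        finally have "column (tuples m X) (tensor_mat m E j) z x = (\<Sum>p\<in>P. c p * chi X T p (x i)) * d"
          using True by (simp add: tensor_column[OF z] tensor_vec_def c)
        also have "\<dots> = (\<Sum>p\<in>P. (c p * d) * b (i, p) x)"
          unfolding sum_distrib_right
          by (intro sum.cong) (simp_all add: b_entry[OF i True])
        finally show ?thesis .
      qed (simp add: column_def b_def tensor_vec_def)
    qed
    also have "\<dots> \<in> vec_span ({1..m} \<times> P) b"
      using fin i by (intro vec_span_combination vec_span_generator) auto
    finally show "column (tuples m X) (tensor_mat m E j) z \<in> vec_span ({1..m} \<times> P) b" .
  qed
  ultimately show ?thesis unfolding incidence_power_def b_def by blast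
qed

section \<open>Weak duality\<close>

text \<open>
  Let \<open>n = \<Sum>\<^sub>p \<chi>\<^sub>p \<chi>\<^sub>p\<^sup>T\<close>, so \<open>n x y = |T x \<inter> T y|\<close>. The entry conditions bound the
  inner product of \<open>n\<close> and \<open>Q\<close> by \<open>r |Y| \<beta> - \<Sum>\<^sub>p d\<^sub>p\<^sup>2\<close>, with \<open>d p\<close> the number of
  points \<open>x\<close> with \<open>p \<in> T x\<close>. As the \<open>d p\<close> have mean \<open>\<beta> = r|Y|/|P|\<close>, the bound is at most \<open>0\<close> by
  the Cauchy--Schwarz inequality. But the inner product is also the sum of the nonnegative forms
  \<open>\<chi>\<^sub>p\<^sup>T Q \<chi>\<^sub>p\<close>, so all of these vanish.
\<close>

lemma dual_certificate_kills_chi: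
  assumes fin: "finite Y" and rep: "disjointness_rep Y adj P r T"
    and Q: "dual_certificate Y adj (real r * real (card Y) / real (card P)) Q" and p: "p \<in> P"
  shows "mat_vec Y Q (chi Y T p) = (\<lambda>x. 0)"
proof -
  define \<beta> where "\<beta> = real r * real (card Y) / real (card P)"
  define e :: "'b \<Rightarrow> 'a \<Rightarrow> real" where "e = (\<lambda>p x. of_bool (p \<in> T x))"
  define n where "n = (\<lambda>x y. \<Sum>p\<in>P. e p x * e p y)"
  define g where "g = (\<lambda>p. \<Sum>x\<in>Y. \<Sum>y\<in>Y. e p x * Q x y * e p y)"
  define d where "d = (\<lambda>p. \<Sum>x\<in>Y. e p x)"
  have finP: "finite P" and cardP: "real (card P) > 0"
    using rep p by (auto simp: disjointness_rep_def card_gt_0_iff)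
  have sym: "symmetric_mat Y Q" and psd: "psd_mat Y Q" using Q by (auto simp: dual_certificate_def)
  have row: "(\<Sum>p\<in>P. e p x) = real r" if "x \<in> Y" for x
  proof -
    have "P \<inter> {p. p \<in> T x} = T x" using rep that by (auto simp: disjointness_rep_def)
    then show ?thesis using rep that finP by (simp add: e_def sum_of_bool_eq disjointness_rep_def)
  qed
  \<comment> \<open>On edges \<open>n\<close> vanishes, and on other off-diagonal pairs \<open>Q\<close> is at most \<open>-1\<close>.\<close>
  have bound: "n x y * Q x y \<le> (if x = y then real r * \<beta> else 0) - n x y" if xy: "x \<in> Y" "y \<in> Y" for x y
  proof (cases "x = y")
    case True
    have "n x x = (\<Sum>p\<in>P. e p x)" unfolding n_def by (intro sum.cong) (auto simp: e_def)
    then have "n x x = real r" using row xy by simp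
    moreover have "Q x x = \<beta> - 1" using Q xy by (simp add: dual_certificate_def \<beta>_def)
    ultimately have "n x x * Q x x = real r * \<beta> - n x x" by (simp add: right_diff_distrib)
    then show ?thesis using True by simp
  next
    case ne: False
    show ?thesis
    proof (cases "adj x y")
      case True
      then have "T x \<inter> T y = {}" using rep xy by (auto simp: disjointness_rep_def)
      then have "n x y = 0" unfolding n_def by (intro sum.neutral) (auto simp: e_def)
      then show ?thesis using ne by simp
    next
      case False
      then have "Q x y \<le> - 1" using Q xy ne by (auto simp: dual_certificate_def)
      moreover have "n x y \<ge> 0" unfolding n_def by (intro sum_nonneg) (auto simp: e_def)
      ultimately have "n x y * Q x y \<le> n x y * (- 1)" by (intro mult_left_mono)
      then show ?thesis using ne by simp
    qed
  qed
  have n_sum: "(\<Sum>x\<in>Y. \<Sum>y\<in>Y. n x y) = (\<Sum>p\<in>P. (d p)\<^sup>2)"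
  proof -
    have "(\<Sum>x\<in>Y. \<Sum>y\<in>Y. n x y) = (\<Sum>x\<in>Y. \<Sum>p\<in>P. \<Sum>y\<in>Y. e p x * e p y)"
      unfolding n_def by (intro sum.cong refl sum.swap)
    also have "\<dots> = (\<Sum>p\<in>P. \<Sum>x\<in>Y. \<Sum>y\<in>Y. e p x * e p y)" by (rule sum.swap)
    finally show ?thesis by (simp add: d_def power2_eq_square sum_product)
  qed
  have d_sum: "(\<Sum>p\<in>P. d p) = real r * real (card Y)"
    unfolding d_def by (subst sum.swap) (simp add: row)
  have "0 \<le> (\<Sum>p\<in>P. (d p - \<beta>)\<^sup>2)" by (intro sum_nonneg) simp
  also have "\<dots> = (\<Sum>p\<in>P. (d p)\<^sup>2) - 2 * \<beta> * (\<Sum>p\<in>P. d p) + real (card P) * \<beta>\<^sup>2"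
    unfolding sum_distrib_left by (simp add: power2_diff sum.distrib sum_subtractf mult_ac)
  also have "real (card P) * \<beta>\<^sup>2 = \<beta> * (real r * real (card Y))"
    using cardP by (simp add: \<beta>_def power2_eq_square)
  finally have square: "real r * real (card Y) * \<beta> \<le> (\<Sum>p\<in>P. (d p)\<^sup>2)"
    by (simp add: d_sum algebra_simps)
  have "(\<Sum>p\<in>P. g p) = (\<Sum>x\<in>Y. \<Sum>p\<in>P. \<Sum>y\<in>Y. e p x * Q x y * e p y)"
    unfolding g_def by (rule sum.swap)
  also have "\<dots> = (\<Sum>x\<in>Y. \<Sum>y\<in>Y. \<Sum>p\<in>P. e p x * Q x y * e p y)"
    by (intro sum.cong refl sum.swap)
  also have "\<dots> = (\<Sum>x\<in>Y. \<Sum>y\<in>Y. n x y * Q x y)"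
    unfolding n_def sum_distrib_right by (intro sum.cong) (simp_all add: mult_ac)
  also have "\<dots> \<le> (\<Sum>x\<in>Y. \<Sum>y\<in>Y. (if x = y then real r * \<beta> else 0) - n x y)"
    by (intro sum_mono bound)
  also have "\<dots> = real r * real (card Y) * \<beta> - (\<Sum>p\<in>P. (d p)\<^sup>2)"
    using fin by (simp add: sum_subtractf n_sum)
  also have "\<dots> \<le> 0" using square by simp
  finally have "(\<Sum>p\<in>P. g p) \<le> 0" .
  moreover have g_nonneg: "g p \<ge> 0" for p using psd unfolding psd_mat_def g_def by (rule spec)
  ultimately have "(\<Sum>p\<in>P. g p) = 0" by (intro antisym sum_nonneg)
  then have "g p = 0" using finP g_nonneg p by (simp add: sum_nonneg_eq_0_iff)
  then have zero: "(\<Sum>y\<in>Y. Q x y * e p y) = 0" if "x \<in> Y" for x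
    using that unfolding g_def by (intro psd_isotropic_kernel[OF fin sym psd])
  show ?thesis
  proof
    fix x
    have "(\<Sum>y\<in>Y. complex_of_real (Q x y) * chi Y T p y) = complex_of_real (\<Sum>y\<in>Y. Q x y * e p y)"
      unfolding of_real_sum by (intro sum.cong) (auto simp: chi_def e_def)
    then show "mat_vec Y Q (chi Y T p) x = 0"
      using zero[of x] unfolding mat_vec_def by (simp only: of_real_0 if_cancel split: if_split) simp
  qed
qed

section \<open>The first power\<close>

text \<open>
  The certificate for \<open>m = 1\<close> lives on tuples of length one; it is carried back to \<open>X\<close> along the
  bijection \<open>emb\<close>.
\<close>

lemma Schrijver_rigid_base_certificate:
  assumes "Schrijver_rigid X adj P r T"
  obtains Q where "dual_certificate X adj (real r * real (card X) / real (card P)) Q"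
    and "kernel X Q = incidence_space X P T"
proof -
  define \<beta> where "\<beta> = real r * real (card X) / real (card P)"
  obtain Q1 where Q1: "dual_certificate (tuples 1 X) (power_adj 1 adj) \<beta> Q1"
    and ker1: "kernel (tuples 1 X) Q1 = incidence_power 1 X P T"
    using assms unfolding Schrijver_rigid_def \<beta>_def by (metis order_refl power_one_right)
  define emb :: "'a \<Rightarrow> nat \<Rightarrow> 'a" where "emb = (\<lambda>x. \<lambda>k\<in>{1..1}. x)"
  have emb1 [simp]: "emb x 1 = x" "emb x (Suc 0) = x" for x by (simp_all add: emb_def)
  have emb_in: "emb x \<in> tuples 1 X" if "x \<in> X" for x
    unfolding emb_def by (rule tuples_restrict) (rule that)
  have emb_eq: "t = emb (t 1)" if t: "t \<in> tuples 1 X" for t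
    using t emb_in[OF tuples_nth[OF t, of 1]] by (subst tuples_eq_iff[OF t]) auto
  have bij: "bij_betw emb X (tuples 1 X)"
    by (rule bij_betw_byWitness[of _ "\<lambda>t. t 1"])
       (use emb_in emb_eq tuples_nth[of _ 1 X 1] in \<open>auto simp: eq_commute\<close>)
  have sum_emb: "(\<Sum>t\<in>tuples 1 X. h t) = (\<Sum>x\<in>X. h (emb x))" for h :: "(nat \<Rightarrow> 'a) \<Rightarrow> 'c::comm_monoid_add"
    using sum.reindex_bij_betw[OF bij, of h] by simp
  define Q where "Q = (\<lambda>x y. Q1 (emb x) (emb y))"
  have cert: "dual_certificate X adj \<beta> Q"
    unfolding dual_certificate_def
  proof (intro conjI ballI impI)
    show "symmetric_mat X Q"
      using Q1 emb_in by (simp add: dual_certificate_def symmetric_mat_def mat_eq_def Q_def)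
    show "psd_mat X Q"
      unfolding psd_mat_def
    proof
      fix u :: "'a \<Rightarrow> real"
      have "0 \<le> (\<Sum>s\<in>tuples 1 X. \<Sum>t\<in>tuples 1 X. u (s 1) * Q1 s t * u (t 1))"
        using Q1 unfolding dual_certificate_def psd_mat_def
        by (elim conjE allE[of _ "\<lambda>t. u (t 1)"])
      then show "0 \<le> (\<Sum>x\<in>X. \<Sum>y\<in>X. u x * Q x y * u y)"
        unfolding sum_emb emb1 Q_def .
    qed
    show "Q x x = \<beta> - 1" if "x \<in> X" for x
      using Q1 emb_in[OF that] by (simp add: dual_certificate_def Q_def)
    show "Q x y \<le> -1" if "x \<in> X" "y \<in> X" "x \<noteq> y \<and> \<not> adj x y" for x y
    proof -
      have "emb x \<noteq> emb y" using that(3) emb1(1)[of x] emb1(1)[of y] by metis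
      moreover have "\<not> power_adj 1 adj (emb x) (emb y)" using that(3) by (simp add: power_adj_def)
      ultimately show ?thesis
        using Q1 emb_in that(1,2) by (simp add: dual_certificate_def Q_def)
    qed
  qed
  define lift :: "('a \<Rightarrow> complex) \<Rightarrow> (nat \<Rightarrow> 'a) \<Rightarrow> complex"
    where "lift = (\<lambda>u t. if t \<in> tuples 1 X then u (t 1) else 0)"
  have lift_inj: "u = v" if "u \<in> cvecs X" "v \<in> cvecs X" "lift u = lift v" for u v
  proof
    fix x
    have "lift u (emb x) = lift v (emb x)" using that(3) by simp
    then show "u x = v x"
      using that(1,2) emb_in[of x] by (cases "x \<in> X") (simp_all add: lift_def cvecs_def)
  qed
  have lift_cvecs: "lift u \<in> cvecs (tuples 1 X)" for u by (simp add: lift_def cvecs_def)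
  have lift_mat_vec: "mat_vec (tuples 1 X) Q1 (lift u) = lift (mat_vec X Q u)" for u
  proof
    fix t
    show "mat_vec (tuples 1 X) Q1 (lift u) t = lift (mat_vec X Q u) t"
    proof (cases "t \<in> tuples 1 X")
      case True
      have "(\<Sum>y\<in>X. complex_of_real (Q1 t (emb y)) * lift u (emb y)) =
            (\<Sum>y\<in>X. complex_of_real (Q (t 1) y) * u y)"
        using emb_in emb_eq[OF True] by (intro sum.cong) (auto simp: Q_def lift_def)
      moreover have "t 1 \<in> X" using tuples_nth[OF True] by simp
      moreover have "lift (mat_vec X Q u) t = mat_vec X Q u (t 1)" using True by (simp add: lift_def)
      ultimately show ?thesis using True unfolding mat_vec_def sum_emb by (simp only: if_True)
    qed (simp add: mat_vec_def lift_def)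
  qed
  have "u \<in> kernel X Q \<longleftrightarrow> u \<in> incidence_space X P T" for u
  proof (cases "u \<in> cvecs X")
    case True
    have zero: "lift (\<lambda>x. 0) = (\<lambda>t. 0)" by (simp add: lift_def fun_eq_iff)
    have "u \<in> kernel X Q \<longleftrightarrow> mat_vec X Q u = (\<lambda>x. 0)" using True by (simp add: kernel_def)
    also have "\<dots> \<longleftrightarrow> lift (mat_vec X Q u) = lift (\<lambda>x. 0)"
      using lift_inj[of "mat_vec X Q u" "\<lambda>x. 0"] by (auto simp: cvecs_def mat_vec_def)
    also have "\<dots> \<longleftrightarrow> lift u \<in> incidence_power 1 X P T"
      unfolding ker1[symmetric] kernel_def zero using lift_cvecs lift_mat_vec by simp
    also have "\<dots> \<longleftrightarrow> (\<exists>c. lift u = (\<lambda>t. \<Sum>p\<in>P. c (1::nat, p) * lift (chi X T p) t))"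
    proof -
      have gen: "tensor_vec 1 X (\<lambda>k. if k = 1 then chi X T p else ones X) = lift (chi X T p)" for p
        by (auto simp: tensor_vec_def lift_def)
      have "(\<Sum>q\<in>{1..1} \<times> P. c q * (case q of (i, p) \<Rightarrow>
              tensor_vec 1 X (\<lambda>k. if k = i then chi X T p else ones X)) t) =
            (\<Sum>p\<in>P. c (1::nat, p) * lift (chi X T p) t)" for c t
      proof -
        have img: "{1..1} \<times> P = Pair (1::nat) ` P" by auto
        have inj: "inj_on (Pair (1::nat)) P" by (simp add: inj_on_def)
        show ?thesis
          unfolding img sum.reindex[OF inj] by (simp only: o_def split_conv gen)
      qed
      then show ?thesis unfolding incidence_power_def vec_span_def by (simp only: mem_Collect_eq)
    qed
    also have "\<dots> \<longleftrightarrow> (\<exists>c. u = (\<lambda>x. \<Sum>p\<in>P. c p * chi X T p x))"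
    proof
      assume "\<exists>c. lift u = (\<lambda>t. \<Sum>p\<in>P. c (1::nat, p) * lift (chi X T p) t)"
      then obtain c where "lift u = (\<lambda>t. \<Sum>p\<in>P. c (1::nat, p) * lift (chi X T p) t)" by blast
      also have "\<dots> = lift (\<lambda>x. \<Sum>p\<in>P. c (1, p) * chi X T p x)" by (auto simp: lift_def)
      finally have "u = (\<lambda>x. \<Sum>p\<in>P. c (1, p) * chi X T p x)"
        by (intro lift_inj[OF True]) (auto simp: cvecs_def chi_def)
      then show "\<exists>c. u = (\<lambda>x. \<Sum>p\<in>P. c p * chi X T p x)"
        by (rule exI[of _ "\<lambda>p. c (1, p)"])
    next
      assume "\<exists>c. u = (\<lambda>x. \<Sum>p\<in>P. c p * chi X T p x)"
      then obtain c where "u = (\<lambda>x. \<Sum>p\<in>P. c p * chi X T p x)" by blast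
      then have "lift u = (\<lambda>t. \<Sum>p\<in>P. (c \<circ> snd) (1::nat, p) * lift (chi X T p) t)"
        by (auto simp: lift_def)
      then show "\<exists>c. lift u = (\<lambda>t. \<Sum>p\<in>P. c (1::nat, p) * lift (chi X T p) t)"
        by (rule exI[of _ "c \<circ> snd"])
    qed
    finally show ?thesis by (simp add: incidence_space_def vec_span_def)
  next
    case False
    moreover have "incidence_space X P T \<subseteq> cvecs X"
      by (auto simp: incidence_space_def vec_span_def cvecs_def chi_def)
    ultimately show ?thesis by (auto simp: kernel_def)
  qed
  then show ?thesis using cert that unfolding \<beta>_def by blast
qed

section \<open>Delsarte-rigidity and Schrijver-rigidity\<close>

text \<open>
  The coefficient of \<open>E\<^sub>0\<close> in \<open>N F - J\<close> is \<open>N - N = 0\<close>. This puts the constants into the kernel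
  and accounts for the exclusion of the zero index in the last condition of Delsarte-rigidity.
\<close>

lemma Schrijver_rigid_if_Delsarte_rigid:
  assumes sch: "scheme_bases X {..s} 0 A E" and \<Gamma>: "\<Gamma> \<subseteq> {..s}"
    and rep: "disjointness_rep X (derived_adj A \<Gamma>) P r T"
    and D: "Delsarte_rigid X s A E \<Gamma> P r T"
  shows "Schrijver_rigid X (derived_adj A \<Gamma>) P r T"
  unfolding Schrijver_rigid_def
proof (intro allI impI)
  fix m :: nat assume m: "m \<ge> 1"
  interpret scheme_bases X "{..s}" 0 A E by (rule sch)
  interpret pw: scheme_bases "tuples m X" "tuples m {..s}" "zero_index m" "tensor_mat m A" "tensor_mat m E"
    by (rule tensor_power_scheme_bases[OF sch])
  have finP: "finite P" using rep unfolding disjointness_rep_def by blast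
  obtain \<Lambda> F f l where compat: "scheme_compatible X s E P T \<Lambda>"
    and FA: "mat_eq (tuples m X) F (\<lambda>x y. \<Sum>i\<in>tuples m {..s}. f i * tensor_mat m A i x y)"
    and FE: "mat_eq (tuples m X) F (\<lambda>x y. \<Sum>j\<in>tuples m {..s}. l j * tensor_mat m E j x y)"
    and l0: "l (zero_index m) = 1"
    and l_nonneg: "\<forall>j\<in>tuples m {..s}. j \<noteq> zero_index m \<longrightarrow> l j \<ge> 0"
    and f0: "f (zero_index m) = real r / real (card P)"
    and f_nonpos: "\<forall>i\<in>tuples m {..s}. i \<notin> tuples m \<Gamma> \<union> {zero_index m} \<longrightarrow> f i \<le> 0"
    and l_iff: "\<forall>j\<in>tuples m {..s}. l j = 0 \<longleftrightarrow> j \<in> index_power m \<Lambda> - {zero_index m}"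
    using D m unfolding Delsarte_rigid_def
    by (elim exE conjE) (erule allE[of _ m], erule impE, assumption, elim exE conjE, rule that, assumption+)
  define N where "N = real (card (tuples m X))"
  have N: "N > 0" using pw.finite_Y pw.Y_nonempty by (simp add: N_def card_gt_0_iff)
  have N_eq: "N = real (card X) ^ m" by (simp add: N_def card_tuples finite_Y)
  define Q where "Q = (\<lambda>x y. N * F x y + (- 1))"
  define f' where "f' = (\<lambda>i. N * f i + (- 1))"
  define l' where "l' = (\<lambda>j. N * l j + (if j = zero_index m then (- 1) * N else 0))"
  have QA: "Q x y = (\<Sum>i\<in>tuples m {..s}. f' i * tensor_mat m A i x y)"
    if "x \<in> tuples m X" "y \<in> tuples m X" for x y
    unfolding f'_def pw.A_combination_shift[OF that, symmetric]
    using FA that by (simp add: Q_def mat_eq_def sum_distrib_left mult.assoc)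
  have QE: "Q x y = (\<Sum>j\<in>tuples m {..s}. l' j * tensor_mat m E j x y)"
    if "x \<in> tuples m X" "y \<in> tuples m X" for x y
    unfolding l'_def N_def pw.E_combination_shift[OF that, symmetric]
    using FE that by (simp add: Q_def N_def mat_eq_def sum_distrib_left mult.assoc)
  have zI: "zero_index m \<in> index_power m \<Lambda>" by (simp add: index_power_def)
  have l'_iff: "l' j = 0 \<longleftrightarrow> j \<in> index_power m \<Lambda>" if "j \<in> tuples m {..s}" for j
    using l_iff[rule_format, OF that] l0 zI N by (auto simp: l'_def)
  have "dual_certificate (tuples m X) (power_adj m (derived_adj A \<Gamma>))
      (real r * real (card X) ^ m / real (card P)) Q"
  proof (rule pw.dual_certificate_of_coefficients[where S = "tuples m \<Gamma>", OF QA QE])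
    show "l' j \<ge> 0" if "j \<in> tuples m {..s}" for j
      using l_nonneg that l0 N by (auto simp: l'_def)
    show "f' (zero_index m) = real r * real (card X) ^ m / real (card P) - 1"
      by (simp add: f'_def f0 N_eq)
    show "f' i \<le> - 1" if "i \<in> tuples m {..s}" "i \<notin> tuples m \<Gamma> \<union> {zero_index m}" for i
      using f_nonpos[rule_format, OF that] N by (simp add: f'_def mult_nonneg_nonpos)
  qed (use power_adj_iff[OF sch \<Gamma>] in blast)+
  moreover have "kernel (tuples m X) Q = incidence_power m X P T"
  proof -
    have "kernel (tuples m X) Q =
        spectral_space (tuples m X) (tuples m {..s}) (tensor_mat m E) (index_power m \<Lambda>)"
      by (rule pw.kernel_eq_spectral_space[OF QE l'_iff])
    then show ?thesis
      using incidence_power_eq_spectral_space[OF sch finP m] compat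
      unfolding scheme_compatible_iff[OF sch rep] by simp
  qed
  ultimately show "\<exists>Q. dual_certificate (tuples m X) (power_adj m (derived_adj A \<Gamma>))
      (real r * real (card X) ^ m / real (card P)) Q \<and>
      kernel (tuples m X) Q = incidence_power m X P T" by blast
qed

text \<open>
  The eigenspaces with vanishing coefficient are those contained in \<open>ker Q = \<L>\<close>, which gives one
  inclusion. For the other, the projection \<open>Q'\<close> of \<open>Q\<close> is a dual certificate at the tight value,
  hence kills every \<open>\<chi>\<^sub>p\<close>; so does then each \<open>E j\<close> with nonzero coefficient.
\<close>

lemma incidence_space_spectral_if_certificate:
  assumes sch: "scheme_bases X {..s} 0 A E" and \<Gamma>: "\<Gamma> \<subseteq> {..s}"
    and rep: "disjointness_rep X (derived_adj A \<Gamma>) P r T"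
    and Q: "dual_certificate X (derived_adj A \<Gamma>) (real r * real (card X) / real (card P)) Q"
    and ker: "kernel X Q = incidence_space X P T"
  shows "incidence_space X P T = spectral_space X {..s} E {j \<in> {..s}. proj_coeff X Q (E j) = 0}"
proof -
  interpret scheme_bases X "{..s}" 0 A E by (rule sch)
  define S where "S = {j \<in> {..s}. proj_coeff X Q (E j) = 0}"
  have sym: "symmetric_mat X Q" and psd: "psd_mat X Q" using Q by (auto simp: dual_certificate_def)
  have "spectral_space X {..s} E S \<subseteq> incidence_space X P T"
    unfolding incidence_space_def
  proof (rule spectral_space_subset_span)
    fix j z assume "j \<in> {..s}" "j \<in> S" "z \<in> X"
    then have "column X (E j) z \<in> kernel X Q"
      using proj_coeff_E_eq_0_iff[OF sym psd] by (auto simp: S_def)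
    then show "column X (E j) z \<in> vec_span P (chi X T)"
      unfolding ker incidence_space_def .
  qed
  moreover have "incidence_space X P T \<subseteq> spectral_space X {..s} E S"
    unfolding incidence_space_def
  proof (rule span_subset_spectral_space)
    fix p assume p: "p \<in> P"
    define Q' where "Q' = (\<lambda>x y. \<Sum>i\<le>s. proj_coeff X Q (A i) * A i x y)"
    have Q'E: "Q' x y = (\<Sum>j\<le>s. proj_coeff X Q (E j) * E j x y)" if "x \<in> X" "y \<in> X" for x y
      unfolding Q'_def by (rule projection_in_both_bases[OF that])
    have "dual_certificate X (derived_adj A \<Gamma>) (real r * real (card X) / real (card P)) Q'"
    proof (rule dual_certificate_of_coefficients[where S = \<Gamma>, OF _ Q'E])
      show "proj_coeff X Q (A i) \<le> -1" if "i \<in> {..s}" "i \<notin> \<Gamma> \<union> {0}" for i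
        using projected_certificate_coefficients(2)[OF Q derived_adj_iff[OF sch \<Gamma>] that] .
      show "proj_coeff X Q (A 0) = real r * real (card X) / real (card P) - 1"
        using projected_certificate_coefficients(1)[OF Q derived_adj_iff[OF sch \<Gamma>]] .
    qed (use proj_coeff_E_nonneg[OF psd] derived_adj_iff[OF sch \<Gamma>] in \<open>simp_all add: Q'_def\<close>)
    then have "mat_vec X Q' (chi X T p) = (\<lambda>x. 0)"
      using dual_certificate_kills_chi[OF finite_Y rep _ p] by blast
    then have "\<forall>j\<in>{..s}. proj_coeff X Q (E j) = 0 \<or> mat_vec X (E j) (chi X T p) = (\<lambda>x. 0)"
      using spectral_kernel[OF Q'E] by blast
    then show "chi X T p \<in> spectral_space X {..s} E S"
      by (auto simp: spectral_space_def S_def cvecs_def chi_def)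
  qed
  ultimately show ?thesis unfolding S_def by blast
qed

text \<open>
  The index set \<open>\<Lambda>\<close> is read off from the certificate for \<open>m = 1\<close>, and the same \<open>\<Lambda>\<close> then works for
  every \<open>m\<close>, because it determines \<open>\<L>\<^bsup>[m]\<^esup>\<close> and with it the kernel of the \<open>m\<close>-th certificate.
\<close>

lemma Delsarte_rigid_if_Schrijver_rigid:
  assumes sch: "scheme_bases X {..s} 0 A E" and \<Gamma>: "\<Gamma> \<subseteq> {..s}"
    and rep: "disjointness_rep X (derived_adj A \<Gamma>) P r T"
    and R: "Schrijver_rigid X (derived_adj A \<Gamma>) P r T"
  shows "Delsarte_rigid X s A E \<Gamma> P r T"
proof -
  interpret scheme_bases X "{..s}" 0 A E by (rule sch)
  have finP: "finite P" using rep unfolding disjointness_rep_def by blast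
  obtain Q1 where Q1: "dual_certificate X (derived_adj A \<Gamma>) (real r * real (card X) / real (card P)) Q1"
    and ker1: "kernel X Q1 = incidence_space X P T"
    using Schrijver_rigid_base_certificate[OF R] .
  define S where "S = {j \<in> {..s}. proj_coeff X Q1 (E j) = 0}"
  define \<Lambda> where "\<Lambda> = S - {0}"
  have LS: "incidence_space X P T = spectral_space X {..s} E S"
    unfolding S_def by (rule incidence_space_spectral_if_certificate[OF sch \<Gamma> rep Q1 ker1])
  have "0 \<in> S"
  proof (rule ccontr)
    assume "0 \<notin> S"
    then have "(\<Sum>y\<in>X. ones X y) = 0"
      using ones_in_incidence_space[OF rep] unfolding LS E_i0_mat_vec_eq_0_iff[symmetric]
      by (simp add: spectral_space_def)
    then show False using finite_Y Y_nonempty by (simp add: ones_def)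
  qed
  then have "insert 0 \<Lambda> = S" by (auto simp: \<Lambda>_def)
  then have L: "incidence_space X P T = spectral_space X {..s} E (insert 0 \<Lambda>)" using LS by simp
  have "\<Lambda> \<subseteq> {1..s}" by (auto simp: \<Lambda>_def S_def)
  then have compat: "scheme_compatible X s E P T \<Lambda>"
    unfolding scheme_compatible_iff[OF sch rep] using L by simp
  show ?thesis
    unfolding Delsarte_rigid_def
  proof (intro exI[of _ \<Lambda>] conjI compat allI impI)
    fix m :: nat assume m: "m \<ge> 1"
    interpret pw: scheme_bases "tuples m X" "tuples m {..s}" "zero_index m" "tensor_mat m A" "tensor_mat m E"
      by (rule tensor_power_scheme_bases[OF sch])
    define N where "N = real (card (tuples m X))"
    have N: "N > 0" using pw.finite_Y pw.Y_nonempty by (simp add: N_def card_gt_0_iff)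
    have N_eq: "N = real (card X) ^ m" by (simp add: N_def card_tuples finite_Y)
    obtain Q where Q: "dual_certificate (tuples m X) (power_adj m (derived_adj A \<Gamma>))
        (real r * real (card X) ^ m / real (card P)) Q"
      and ker: "kernel (tuples m X) Q = incidence_power m X P T"
      using R m unfolding Schrijver_rigid_def by blast
    have sym: "symmetric_mat (tuples m X) Q" and psd: "psd_mat (tuples m X) Q"
      using Q by (auto simp: dual_certificate_def)
    define q where "q = (\<lambda>i. proj_coeff (tuples m X) Q (tensor_mat m A i))"
    define p where "p = (\<lambda>j. proj_coeff (tuples m X) Q (tensor_mat m E j))"
    have p_iff: "p j = 0 \<longleftrightarrow> j \<in> index_power m \<Lambda>" if "j \<in> tuples m {..s}" for j
      unfolding p_def pw.proj_coeff_E_eq_0_iff[OF sym psd that] ker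
        incidence_power_eq_spectral_space[OF sch finP m L]
      by (rule pw.columns_in_spectral_space_iff[OF that])
    have zI: "zero_index m \<in> index_power m \<Lambda>" by (simp add: index_power_def)
    have p0: "p (zero_index m) = 0" using p_iff[OF pw.i0_in_I] zI by blast
    define F where "F = (\<lambda>x y. ((\<Sum>i\<in>tuples m {..s}. q i * tensor_mat m A i x y) + 1) / N)"
    define f where "f = (\<lambda>i. (q i + 1) / N)"
    define l where "l = (\<lambda>j. (p j + (if j = zero_index m then 1 * N else 0)) / N)"
    have FA: "F x y = (\<Sum>i\<in>tuples m {..s}. f i * tensor_mat m A i x y)"
      if "x \<in> tuples m X" "y \<in> tuples m X" for x y
      unfolding F_def pw.A_combination_shift[OF that] by (simp add: f_def sum_divide_distrib)
    have FE: "F x y = (\<Sum>j\<in>tuples m {..s}. l j * tensor_mat m E j x y)"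
      if "x \<in> tuples m X" "y \<in> tuples m X" for x y
      unfolding F_def q_def pw.projection_in_both_bases[OF that] pw.E_combination_shift[OF that]
      by (simp add: l_def p_def N_def sum_divide_distrib cong: if_cong)
    note coeffs = pw.projected_certificate_coefficients[OF Q power_adj_iff[OF sch \<Gamma>]]
    have q0: "q (zero_index m) = real r * N / real (card P) - 1"
      unfolding q_def N_eq by (rule coeffs(1))
    have "symmetric_mat (tuples m X) F"
      unfolding symmetric_mat_def mat_eq_def by (auto simp: FE pw.E_sym intro!: sum.cong)
    moreover have "mat_eq (tuples m X) F (\<lambda>x y. \<Sum>i\<in>tuples m {..s}. f i * tensor_mat m A i x y)"
      by (simp add: mat_eq_def FA)
    moreover have "mat_eq (tuples m X) F (\<lambda>x y. \<Sum>j\<in>tuples m {..s}. l j * tensor_mat m E j x y)"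
      by (simp add: mat_eq_def FE)
    moreover have "complexify F \<in> mat_span (tuples m X) (tuples m {..s}) (tensor_mat m A)"
      unfolding mat_span_def mat_eq_def
      by (intro CollectI exI[of _ "\<lambda>i. complex_of_real (f i)"])
         (simp add: complexify_def mat_comb_def FA)
    moreover have "l (zero_index m) = 1"
      using p0 N by (simp add: l_def)
    moreover have "\<forall>j\<in>tuples m {..s}. j \<noteq> zero_index m \<longrightarrow> l j \<ge> 0"
      using pw.proj_coeff_E_nonneg[OF psd] N by (simp add: l_def p_def)
    moreover have "f (zero_index m) = real r / real (card P)"
      using N by (simp add: f_def q0)
    moreover have "\<forall>i\<in>tuples m {..s}. i \<notin> tuples m \<Gamma> \<union> {zero_index m} \<longrightarrow> f i \<le> 0"
    proof (intro ballI impI)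
      fix i assume i: "i \<in> tuples m {..s}" "i \<notin> tuples m \<Gamma> \<union> {zero_index m}"
      have "q i \<le> - 1" unfolding q_def by (rule coeffs(2)[OF _ _ _ _ i])
      then show "f i \<le> 0" using N by (simp add: f_def divide_le_0_iff)
    qed
    moreover have "\<forall>j\<in>tuples m {..s}. l j = 0 \<longleftrightarrow> j \<in> index_power m \<Lambda> - {zero_index m}"
      using p_iff p0 N by (auto simp: l_def)
    ultimately show "\<exists>F f l. symmetric_mat (tuples m X) F \<and>
        complexify F \<in> mat_span (tuples m X) (tuples m {..s}) (tensor_mat m A) \<and>
        mat_eq (tuples m X) F (\<lambda>x y. \<Sum>i\<in>tuples m {..s}. f i * tensor_mat m A i x y) \<and>
        mat_eq (tuples m X) F (\<lambda>x y. \<Sum>j\<in>tuples m {..s}. l j * tensor_mat m E j x y) \<and>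
        l (zero_index m) = 1 \<and>
        (\<forall>j\<in>tuples m {..s}. j \<noteq> zero_index m \<longrightarrow> l j \<ge> 0) \<and>
        f (zero_index m) = real r / real (card P) \<and>
        (\<forall>i\<in>tuples m {..s}. i \<notin> tuples m \<Gamma> \<union> {zero_index m} \<longrightarrow> f i \<le> 0) \<and>
        (\<forall>j\<in>tuples m {..s}. l j = 0 \<longleftrightarrow> j \<in> index_power m \<Lambda> - {zero_index m})"
      by blast
  qed
qed

theorem lemma2p21:
  fixes X :: "'a set" and s :: nat and A E :: "nat \<Rightarrow> 'a \<Rightarrow> 'a \<Rightarrow> real"
    and \<Gamma> :: "nat set" and P :: "'p set" and r :: nat and T :: "'a \<Rightarrow> 'p set"
  assumes "assoc_scheme X s A"
    and "idempotent_basis X s A E"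
    and "\<Gamma> \<subseteq> {1..s}"
    and "disjointness_rep X (derived_adj A \<Gamma>) P r T"
  shows "Delsarte_rigid X s A E \<Gamma> P r T \<longleftrightarrow> Schrijver_rigid X (derived_adj A \<Gamma>) P r T"
proof -
  have "X \<noteq> {}" using assms(4) by (auto simp: disjointness_rep_def)
  then have sch: "scheme_bases X {..s} 0 A E" by (rule assoc_scheme_bases[OF assms(1,2)])
  have \<Gamma>: "\<Gamma> \<subseteq> {..s}" using assms(3) by auto
  show ?thesis
    using Schrijver_rigid_if_Delsarte_rigid[OF sch \<Gamma> assms(4)]
      Delsarte_rigid_if_Schrijver_rigid[OF sch \<Gamma> assms(4)] by blast
qed

end
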